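(* Let $n\ge 1$ be an integer and $\alpha>0$. Let $Y_1,\dots,Y_{n+1}$ be mutually independent random variables, where $Y_i$ has distribution $V_i\in\mathcal{L}_1(\alpha)$ with associated function $f_i$ (so $\overline{V_i}(x)\sim e^{-\alpha x}f_i(x)$), $1\le i\le n+1$. Then $V_1*\cdots*V_n\in\mathcal{L}_1(\alpha)$ and, as $x\to\infty$, $$\overline{V_1*\cdots *V_n}(x)\sim a^{n-1} e^{-\alpha x}\,f_1\otimes \cdots\otimes f_n(x)=o\big(\overline{V_1*\cdots *V_{n+1}}(x)\big),$$ where: $a=\alpha$ when the distributions $V_i$, $1\le i\le n+1$, are non-lattice; $a=e^\alpha-1$ when they are all lattice; and $a=(e^\alpha-1)^{m/(n-1)}\alpha^{(n-m-1)/(n-1)}$ when $n\ge2$ and there is an integer $1\le m\le n-1$ such that $V_i$ is lattice for $1\le i\le m$ and $V_j$ is non-lattice for $m+1\le j\le n$. Moreover, for any $1\le j\le n+1$, as $x\to\infty$, $$P\big(\max\{Y_i:1\le i\le n+1\}>x\big)=o\Big(\sum_{1\le i\le n+1,\ i\neq j}\overline{V_i*V_j}(x)\Big).$$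
   Context: All limits are as $x\to\infty$. For eventually positive functions $u,v$: $u(x)\sim v(x)$ means $u(x)/v(x)\to1$, and $u(x)=o(v(x))$ means $u(x)/v(x)\to0$. For a distribution $V$ on $\mathbb{R}$, $\overline V=1-V$ is its tail, and $*$ denotes convolution of distributions (the law of the sum of independent random variables). For $\alpha\ge0$, a measurable eventually positive function $u$ belongs to $\mathcal{L}_\alpha$ if $u(x-t)\sim e^{\alpha t}u(x)$ for every $t\in\mathbb{R}$. A distribution $V$ on $\mathbb{R}$ belongs to $\mathcal{L}(\alpha)$ if $\overline V\in\mathcal{L}_\alpha$. If $V\in\mathcal{L}(\alpha)$, one can write $\overline V(x)\sim e^{-\alpha x}f(x)$, where $f$ (the function associated with $V$) is a nonnegative, measurable, eventually positive function, bounded on bounded subsets of $[0,\infty)$, with $f\in\mathcal{L}_0$ (equivalently $f(x)=l(e^x)$ with $l$ slowly varying). For $\alpha>0$, $\mathcal{L}_1(\alpha)$ is the set of $V\in\mathcal{L}(\alpha)$ with $\int_0^\infty f(y)\,dy=\infty$. For nonnegative functions $u,v$: $u\otimes v(x)=\int_0^x u(x-y)v(y)\,dy$ (iterated for several functions). Lattice convention: every lattice distribution is supported on $\mathbb{N}=\{0,1,2,\dots\}$ with step 1. For such $V$, all the relations above are restricted to integer arguments: $V\in\mathcal{L}(\alpha)$ means $\overline V(k-i)\sim e^{\alpha i}\overline V(k)$ as $k\to\infty$ through the integers, for all $i\in\mathbb{N}$; $\overline V(k)\sim e^{-\alpha k}f(k)$ as $k\to\infty$; and the condition $\int_0^\infty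 f=\infty$ reads $\sum_{i\ge0}f(i)=\infty$. In integrals, $f$ is extended from the integers to $[0,\infty)$ by linear interpolation. An asymptotic relation in which the tail of a lattice distribution is evaluated at $x$ is understood with $x\to\infty$ through the integers. *)

theory Defs
  imports "HOL-Probability.Probability" "HOL-Library.Landau_Symbols"
begin

text \<open>Distributions on the real line are represented by Borel probability measures.\<close>

definition tail :: "real measure \<Rightarrow> real \<Rightarrow> real" where
  "tail V x = 1 - cdf V x"

definition concentrated_on_lattice :: "real \<Rightarrow> real \<Rightarrow> real measure \<Rightarrow> bool" where
  "concentrated_on_lattice c h V \<longleftrightarrow> (AE x in V. \<exists>k::int. x = c + h * of_int k)"

definition lattice_dist :: "real measure \<Rightarrow> bool" where
  "lattice_dist V \<longleftrightarrow> (\<exists>c h. h > 0 \<and> concentrated_on_lattice c h V)"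

text \<open>The step of a lattice distribution is the largest \<open>h\<close> such that it is concentrated on some
  \<open>c + h\<int>\<close>.\<close>

definition unit_lattice :: "real measure \<Rightarrow> bool" where
  "unit_lattice V \<longleftrightarrow> (AE x in V. x \<in> \<nat>) \<and>
     (\<forall>c h. h > 0 \<longrightarrow> concentrated_on_lattice c h V \<longrightarrow> h \<le> 1)"

text \<open>The way \<open>x\<close> tends to infinity in an asymptotic relation involving the tails at \<open>x\<close> of the
  distributions in \<open>D\<close>.\<close>

definition arg_filter :: "real measure set \<Rightarrow> real filter" where
  "arg_filter D = (if \<exists>V\<in>D. lattice_dist V then filtermap real sequentially else at_top)"

definition L_fun :: "real \<Rightarrow> (real \<Rightarrow> real) set" where
  "L_fun \<alpha> = {u. u \<in> borel_measurable borel \<and> (\<forall>\<^sub>F x in at_top. u x > 0) \<and>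
     (\<forall>t. (\<lambda>x. u (x - t)) \<sim>[at_top] (\<lambda>x. exp (\<alpha> * t) * u x))}"

text \<open>The analogue for integer arguments; the values of \<open>u\<close> elsewhere are irrelevant.\<close>

definition L_fun_int :: "real \<Rightarrow> (real \<Rightarrow> real) set" where
  "L_fun_int \<alpha> = {u. (\<forall>\<^sub>F k in sequentially. u (real k) > 0) \<and>
     (\<forall>i::nat. (\<lambda>k. u (real k - real i)) \<sim>[sequentially] (\<lambda>k. exp (\<alpha> * real i) * u (real k)))}"

definition L_dist :: "real \<Rightarrow> real measure set" where
  "L_dist \<alpha> = {V. real_distribution V \<and>
     (if lattice_dist V then unit_lattice V \<and> tail V \<in> L_fun_int \<alpha> else tail V \<in> L_fun \<alpha>)}"

text \<open>\<open>f\<close> is a function associated with \<open>V\<close>. Only its values on \<open>[0, \<infinity>)\<close> matter, and only those at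
  the integers if \<open>V\<close> is lattice.\<close>

definition associated :: "real \<Rightarrow> real measure \<Rightarrow> (real \<Rightarrow> real) \<Rightarrow> bool" where
  "associated \<alpha> V f \<longleftrightarrow>
     (if lattice_dist V
      then (\<forall>k::nat. f (real k) \<ge> 0) \<and> f \<in> L_fun_int 0 \<and>
           (\<lambda>k. tail V (real k)) \<sim>[sequentially] (\<lambda>k. exp (- \<alpha> * real k) * f (real k))
      else (\<forall>x\<ge>0. f x \<ge> 0) \<and> f \<in> L_fun 0 \<and>
           (\<forall>B. B \<subseteq> {0..} \<longrightarrow> bounded B \<longrightarrow> bounded (f ` B)) \<and>
           tail V \<sim>[at_top] (\<lambda>x. exp (- \<alpha> * x) * f x))"

definition infinite_mass :: "real measure \<Rightarrow> (real \<Rightarrow> real) \<Rightarrow> bool" where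
  "infinite_mass V f \<longleftrightarrow>
     (if lattice_dist V then (\<Sum>i. ennreal (f (real i))) = \<infinity>
      else (\<integral>\<^sup>+y\<in>{0..}. ennreal (f y) \<partial>lborel) = \<infinity>)"

text \<open>Functions associated with the same distribution are asymptotically equivalent and locally
  bounded, so \<^term>\<open>infinite_mass V f\<close> does not depend on the choice of \<open>f\<close>.\<close>

definition L1_dist :: "real \<Rightarrow> real measure set" where
  "L1_dist \<alpha> = {V \<in> L_dist \<alpha>. \<exists>f. associated \<alpha> V f \<and> infinite_mass V f}"

definition lin_interp :: "(real \<Rightarrow> real) \<Rightarrow> real \<Rightarrow> real" where
  "lin_interp f x = (1 - frac x) * f (of_int \<lfloor>x\<rfloor>) + frac x * f (of_int \<lfloor>x\<rfloor> + 1)"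

text \<open>The version of an associated function that is used inside integrals.\<close>

definition extended :: "real measure \<Rightarrow> (real \<Rightarrow> real) \<Rightarrow> real \<Rightarrow> real" where
  "extended V f = (if lattice_dist V then lin_interp f else f)"

definition otimes :: "(real \<Rightarrow> real) \<Rightarrow> (real \<Rightarrow> real) \<Rightarrow> real \<Rightarrow> real" where
  "otimes u v x = (LBINT y:{0..x}. u (x - y) * v y)"

text \<open>\<open>iterated g u n\<close> combines \<open>u 1, \<dots>, u n\<close> (for \<open>n \<ge> 1\<close>) from the left by the operation \<open>g\<close>.\<close>

definition iterated :: "('a \<Rightarrow> 'a \<Rightarrow> 'a) \<Rightarrow> (nat \<Rightarrow> 'a) \<Rightarrow> nat \<Rightarrow> 'a" where
  "iterated g u n = foldl g (u 1) (map u [2..<n + 1])"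

abbreviation conv_upto :: "(nat \<Rightarrow> real measure) \<Rightarrow> nat \<Rightarrow> real measure" where
  "conv_upto \<equiv> iterated convolution"

text \<open>\<open>rate_const \<alpha> n V a\<close>: the lattice types of the distributions follow one of the three patterns
  for which the constant is specified, and \<open>a\<close> is its value. In the mixed pattern the type of
  \<open>V (n + 1)\<close> is not restricted.\<close>

definition rate_const :: "real \<Rightarrow> nat \<Rightarrow> (nat \<Rightarrow> real measure) \<Rightarrow> real \<Rightarrow> bool" where
  "rate_const \<alpha> n V a \<longleftrightarrow>
     (\<forall>i\<in>{1..n + 1}. \<not> lattice_dist (V i)) \<and> a = \<alpha> \<or>
     (\<forall>i\<in>{1..n + 1}. lattice_dist (V i)) \<and> a = exp \<alpha> - 1 \<or>
     n \<ge> 2 \<and> (\<exists>m\<in>{1..n - 1}.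
       (\<forall>i\<in>{1..m}. lattice_dist (V i)) \<and> (\<forall>j\<in>{m + 1..n}. \<not> lattice_dist (V j)) \<and>
       a = (exp \<alpha> - 1) powr (real m / (real n - 1)) *
           \<alpha> powr ((real n - real m - 1) / (real n - 1)))"

end

theory Submission
  imports Defs
begin

text \<open>
  The tails are compared by means of an exact identity. If \<open>Y\<close> and \<open>Z\<close> are independent with
  distributions \<open>V\<close> and \<open>W\<close>, then Tonelli's theorem gives
  \<open>\<integral> P(Y > y) P(Z > x - y) dy = E (Y + Z - x)\<^sup>+\<close>,
  because the set of those \<open>y\<close> with \<open>x - Z < y < Y\<close> has length \<open>(Y + Z - x)\<^sup>+\<close>. If \<open>Y\<close> is
  integer-valued, the same holds for sums over integer \<open>y\<close>, with \<open>(Y + Z - x)\<^sup>+\<close> replaced by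
  the number of integers strictly between \<open>x - Z\<close> and \<open>Y\<close>
  (\<open>tail_product_integral_eq_overshoot\<close>). Sums over the integers are written as integrals of
  functions of \<open>\<lfloor>y\<rfloor>\<close>, so that one argument treats both kinds of distribution.

  The left-hand side is asymptotically \<open>exp (- \<alpha> x)\<close> times \<open>f \<otimes> g\<close>, where \<open>f\<close> and \<open>g\<close> are
  associated with \<open>V\<close> and \<open>W\<close>. In the range \<open>K \<le> y \<le> x - K\<close> the integrand is a product of tails at
  large arguments and the exponentials combine to \<open>exp (- \<alpha> x)\<close>. The two ends contribute at most a
  constant times \<open>exp (- \<alpha> x) f x\<close> and \<open>exp (- \<alpha> x) g x\<close>; this is negligible, since the
  infinite integral of one factor makes \<open>f \<otimes> g\<close> dominate the other factor
  (\<open>otimes_dominates\<close>, \<open>tail_product_integral_asymp\<close>).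

  The right-hand side \<open>J x\<close> determines the tail \<open>C\<close> of \<open>V \<star> W\<close> by its increments. In the lattice
  case \<open>C x = J (x - 1) - J x\<close>, so the constant is \<open>exp \<alpha> - 1\<close>. Otherwise \<open>h C x\<close> lies between
  \<open>J x - J (x + h)\<close> and \<open>J (x - h) - J x\<close>; after division by \<open>h J x\<close> these bounds tend to
  \<open>(1 - exp (- \<alpha> h)) / h\<close> and \<open>(exp (\<alpha> h) - 1) / h\<close>, and \<open>h \<rightarrow> 0\<close> gives the constant \<open>\<alpha>\<close>
  (\<open>convolution_tail_tendsto\<close>).

  Since \<open>f \<otimes> g\<close> is again slowly varying with infinite integral
  (\<open>slowly_varying_otimes\<close>, \<open>infinite_integral_otimes\<close>), the class is closed under convolution and
  the result can be iterated; each step contributes the factor \<open>exp \<alpha> - 1\<close> if one of the two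
  distributions involved is lattice, and \<open>\<alpha>\<close> otherwise. The domination of the factors by
  \<open>f \<otimes> g\<close> also shows that the tail of \<open>V\<close> is negligible compared with that of \<open>V \<star> W\<close>, and with the
  union bound this gives the statement on the maximum.
\<close>

section \<open>Slowly varying functions and their convolution\<close>

text \<open>Slow variation is required uniformly for shifts in \<open>[0, 1]\<close>. For measurable functions this
  follows from the pointwise condition by the uniform convergence theorem; for associated functions
  it follows directly from the monotonicity of the tail, and it is preserved by \<open>otimes\<close>. With two-sided ratio bounds there is no division by
  values that might vanish.\<close>

definition slowly_varying :: "(real \<Rightarrow> real) \<Rightarrow> bool" where
  "slowly_varying u \<longleftrightarrow> u \<in> borel_measurable borel \<and> (\<forall>x\<ge>0. u x \<ge> 0) \<and>
     (\<forall>B. \<exists>M. \<forall>x\<in>{0..B}. u x \<le> M) \<and> (\<forall>\<^sub>F x in at_top. u x > 0) \<and>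
     (\<forall>e>0. \<forall>\<^sub>F x in at_top. \<forall>t\<in>{0..1}. u (x + t) \<le> (1 + e) * u x \<and> u x \<le> (1 + e) * u (x + t))"

definition infinite_integral :: "(real \<Rightarrow> real) \<Rightarrow> bool" where
  "infinite_integral u \<longleftrightarrow> (\<integral>\<^sup>+y\<in>{0..}. ennreal (u y) \<partial>lborel) = \<infinity>"

lemma slowly_varyingD:
  assumes "slowly_varying u"
  shows "u \<in> borel_measurable borel" and "x \<ge> 0 \<Longrightarrow> u x \<ge> 0"
    and "\<exists>M\<ge>0. \<forall>x\<in>{0..B}. u x \<le> M" and "\<forall>\<^sub>F x in at_top. u x > 0"
    and "e > 0 \<Longrightarrow> \<forall>\<^sub>F x in at_top. \<forall>t\<in>{0..1}. u (x + t) \<le> (1 + e) * u x \<and> u x \<le> (1 + e) * u (x + t)"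
proof -
  obtain M where "\<forall>x\<in>{0..B}. u x \<le> M"
    using assms unfolding slowly_varying_def by blast
  then have "\<forall>x\<in>{0..B}. u x \<le> max M 0" by force
  then show "\<exists>M\<ge>0. \<forall>x\<in>{0..B}. u x \<le> M" by (intro exI[of _ "max M 0"]) auto
qed (use assms in \<open>auto simp: slowly_varying_def\<close>)

lemma iterate_unit_step_ratio:
  fixes u :: "real \<Rightarrow> real"
  assumes step: "\<And>x t. x \<ge> x0 \<Longrightarrow> t \<in> {0..1} \<Longrightarrow> u (x + t) \<le> q * u x \<and> u x \<le> q * u (x + t)"
    and q: "q \<ge> 1" and pos: "\<And>x. x \<ge> x0 \<Longrightarrow> u x \<ge> 0"
  shows "x \<ge> x0 \<Longrightarrow> t \<in> {0..real k} \<Longrightarrow> u (x + t) \<le> q ^ k * u x \<and> u x \<le> q ^ k * u (x + t)"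
proof (induction k arbitrary: x t)
  case 0
  then show ?case by simp
next
  case (Suc k)
  show ?case
  proof (cases "t < 1")
    case True
    have "q \<le> q ^ Suc k" using q by (metis power_increasing power_one_right Suc_le_mono le0 One_nat_def)
    then have "q * u x \<le> q ^ Suc k * u x" "q * u (x + t) \<le> q ^ Suc k * u (x + t)"
      using Suc.prems pos[of x] pos[of "x + t"] by (auto intro!: mult_right_mono simp del: power_Suc)
    then show ?thesis using step[of x t] True Suc.prems by force
  next
    case False
    have *: "u (x + 1) \<le> q * u x" "u x \<le> q * u (x + 1)" using step[of x 1] Suc.prems by auto
    have "u (x + 1 + (t - 1)) \<le> q ^ k * u (x + 1) \<and> u (x + 1) \<le> q ^ k * u (x + 1 + (t - 1))"
      using Suc.prems False by (intro Suc.IH) auto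
    then have ih: "u (x + t) \<le> q ^ k * u (x + 1)" "u (x + 1) \<le> q ^ k * u (x + t)" by auto
    have "u (x + t) \<le> q ^ k * (q * u x)"
      using ih(1) mult_left_mono[OF *(1), of "q ^ k"] q by (meson order_trans zero_le_one zero_le_power)
    moreover have "u x \<le> q * (q ^ k * u (x + t))"
      using *(2) mult_left_mono[OF ih(2), of q] q by (meson order_trans zero_le_one)
    ultimately show ?thesis by (simp add: mult_ac)
  qed
qed

lemma slowly_varying_uniform:
  assumes u: "slowly_varying u" and e: "e > 0"
  shows "\<forall>\<^sub>F x in at_top. \<forall>t\<in>{0..T}. u (x + t) \<le> (1 + e) * u x \<and> u x \<le> (1 + e) * u (x + t)"
proof -
  obtain N :: nat where N: "T \<le> real N" using real_arch_simple by blast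
  define d where "d = root (Suc N) (1 + e) - 1"
  have d: "d > 0" "(1 + d) ^ Suc N = 1 + e"
    using e by (auto simp: d_def simp del: power_Suc)
  have "\<forall>\<^sub>F x in at_top. (\<forall>t\<in>{0..1}. u (x + t) \<le> (1 + d) * u x \<and> u x \<le> (1 + d) * u (x + t)) \<and> x \<ge> 0"
    using slowly_varyingD(5)[OF u d(1)] eventually_ge_at_top[of 0] by eventually_elim auto
  then obtain x0 where x0: "\<And>x. x \<ge> x0 \<Longrightarrow>
      (\<forall>t\<in>{0..1}. u (x + t) \<le> (1 + d) * u x \<and> u x \<le> (1 + d) * u (x + t)) \<and> x \<ge> 0"
    by (auto simp: eventually_at_top_linorder)
  show ?thesis
    using eventually_ge_at_top[of x0]
  proof eventually_elim
    case (elim x)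
    show ?case
    proof
      fix t assume t: "t \<in> {0..T}"
      have "u (x + t) \<le> (1 + d) ^ Suc N * u x \<and> u x \<le> (1 + d) ^ Suc N * u (x + t)"
        by (rule iterate_unit_step_ratio[where ?x0.0 = x0]) (use x0 d elim t N slowly_varyingD(2)[OF u] in auto)
      then show "u (x + t) \<le> (1 + e) * u x \<and> u x \<le> (1 + e) * u (x + t)" by (simp only: d)
    qed
  qed
qed

text \<open>A Potter-type bound: it lets the exponential decay of a tail beat the slowly varying factor when
  the tail is integrated.\<close>

lemma slowly_varying_subexponential:
  assumes u: "slowly_varying u" and r: "r > 0"
  shows "\<exists>x0\<ge>0. \<forall>x\<ge>x0. \<forall>t\<ge>0. u (x + t) \<le> exp (r * (t + 1)) * u x"
proof -
  have d: "exp r - 1 > 0" using r by simp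
  have "\<forall>\<^sub>F x in at_top. (\<forall>t\<in>{0..1}. u (x + t) \<le> exp r * u x \<and> u x \<le> exp r * u (x + t)) \<and> x \<ge> 0"
    using slowly_varyingD(5)[OF u d] eventually_ge_at_top[of 0] by eventually_elim auto
  then obtain x0 where x0: "\<And>x. x \<ge> x0 \<Longrightarrow>
      (\<forall>t\<in>{0..1}. u (x + t) \<le> exp r * u x \<and> u x \<le> exp r * u (x + t)) \<and> x \<ge> 0"
    by (auto simp: eventually_at_top_linorder)
  have "u (x + t) \<le> exp (r * (t + 1)) * u x" if "x \<ge> x0" "t \<ge> 0" for x t
  proof -
    have "u (x + t) \<le> exp r ^ nat \<lceil>t\<rceil> * u x \<and> u x \<le> exp r ^ nat \<lceil>t\<rceil> * u (x + t)"
      by (rule iterate_unit_step_ratio[where ?x0.0 = x0]) (use x0 r that slowly_varyingD(2)[OF u] in auto)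
    moreover have "exp r ^ nat \<lceil>t\<rceil> \<le> exp (r * (t + 1))"
      using that r by (auto simp: exp_of_nat_mult[symmetric])
    ultimately show ?thesis
      using slowly_varyingD(2)[OF u, of x] x0[OF that(1)] by (meson mult_right_mono order_trans)
  qed
  then show ?thesis using x0 by blast
qed

lemma otimes_commute: "otimes u v x = otimes v u x"
proof -
  have "otimes u v x = (\<integral>y. indicator {0..x} (x + (-1) * y) *\<^sub>R (u (x - (x + (-1) * y)) * v (x + (-1) * y)) \<partial>lborel)"
    unfolding otimes_def set_lebesgue_integral_def
    by (subst lborel_integral_real_affine[where c = "-1" and t = x]) auto
  also have "\<dots> = (\<integral>y. indicator {0..x} y *\<^sub>R (v (x - y) * u y) \<partial>lborel)"
    by (intro Bochner_Integration.integral_cong) (auto simp: indicator_def)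
  finally show ?thesis by (simp add: otimes_def set_lebesgue_integral_def)
qed

lemma otimes_eq_nn_integral:
  assumes u: "slowly_varying u" and v: "slowly_varying v"
  shows "ennreal (otimes u v x) = (\<integral>\<^sup>+y\<in>{0..x}. ennreal (u (x - y) * v y) \<partial>lborel)"
proof -
  note [measurable] = slowly_varyingD(1)[OF u] slowly_varyingD(1)[OF v]
  note nn = slowly_varyingD(2)[OF u] slowly_varyingD(2)[OF v]
  obtain M where M: "M \<ge> 0" "\<And>y. y \<in> {0..x} \<Longrightarrow> u y \<le> M" using slowly_varyingD(3)[OF u, of x] by auto
  obtain M' where M': "M' \<ge> 0" "\<And>y. y \<in> {0..x} \<Longrightarrow> v y \<le> M'" using slowly_varyingD(3)[OF v, of x] by auto
  have int: "integrable lborel (\<lambda>y. indicator {0..x} y *\<^sub>R (u (x - y) * v y))"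
  proof (rule Bochner_Integration.integrable_bound[where f = "\<lambda>y. (M * M') * indicator {0..x} y"])
    show "integrable lborel (\<lambda>y. (M * M') * indicator {0..x} y :: real)"
      by (intro integrable_mult_right integrable_real_indicator) (auto simp: emeasure_lborel_Icc_eq)
    show "AE y in lborel. norm (indicator {0..x} y *\<^sub>R (u (x - y) * v y)) \<le> norm (M * M' * indicator {0..x} y)"
      by (auto intro!: AE_I2 mult_mono simp: indicator_def abs_mult M M' nn)
  qed auto
  have "(\<integral>\<^sup>+y\<in>{0..x}. ennreal (u (x - y) * v y) \<partial>lborel) = (\<integral>\<^sup>+y. ennreal (indicator {0..x} y *\<^sub>R (u (x - y) * v y)) \<partial>lborel)"
    by (intro nn_integral_cong) (auto simp: indicator_def)
  also have "\<dots> = ennreal (\<integral>y. indicator {0..x} y *\<^sub>R (u (x - y) * v y) \<partial>lborel)"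
    by (rule nn_integral_eq_integral[OF int]) (auto simp: indicator_def nn)
  finally show ?thesis by (simp add: otimes_def set_lebesgue_integral_def)
qed

lemma otimes_nonneg:
  assumes u: "slowly_varying u" and v: "slowly_varying v"
  shows "otimes u v x \<ge> 0"
  unfolding otimes_def set_lebesgue_integral_def
  by (rule Bochner_Integration.integral_nonneg) (auto simp: indicator_def intro!: mult_nonneg_nonneg slowly_varyingD(2)[OF u] slowly_varyingD(2)[OF v])

text \<open>The end of the convolution integral where the argument of \<open>u\<close> stays bounded: there \<open>u\<close> is
  bounded and \<open>v\<close> is comparable with its value at \<open>x\<close>.\<close>

lemma otimes_edge_le:
  assumes u: "slowly_varying u" and v: "slowly_varying v"
  shows "\<exists>c\<ge>0. \<forall>\<^sub>F x in at_top.
    (\<integral>\<^sup>+y\<in>{x - K..x}. ennreal (u (x - y) * v y) \<partial>lborel) \<le> ennreal (c * v x)"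
proof -
  obtain M where M: "M \<ge> 0" "\<And>y. y \<in> {0..K} \<Longrightarrow> u y \<le> M" using slowly_varyingD(3)[OF u, of K] by auto
  define c where "c = M * 2 * max 0 K"
  have "\<exists>x0. \<forall>x\<ge>x0. \<forall>t\<in>{0..K}. v x \<le> 2 * v (x + t)"
    using slowly_varying_uniform[OF v, of 1 K] by (auto simp: eventually_at_top_linorder)
  then obtain x0 where x0: "\<And>x t. x \<ge> x0 \<Longrightarrow> t \<in> {0..K} \<Longrightarrow> v x \<le> 2 * v (x + t)" by blast
  have "\<forall>\<^sub>F x in at_top.
    (\<integral>\<^sup>+y\<in>{x - K..x}. ennreal (u (x - y) * v y) \<partial>lborel) \<le> ennreal (c * v x)"
    using eventually_ge_at_top[of "x0 + K"] eventually_ge_at_top[of "K"] eventually_ge_at_top[of "0"]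
  proof eventually_elim
    case (elim x)
    have "(\<integral>\<^sup>+y\<in>{x - K..x}. ennreal (u (x - y) * v y) \<partial>lborel)
        \<le> (\<integral>\<^sup>+y. ennreal (M * (2 * v x)) * indicator {x - K..x} y \<partial>lborel)"
    proof (intro nn_integral_mono)
      fix y
      show "ennreal (u (x - y) * v y) * indicator {x - K..x} y \<le> ennreal (M * (2 * v x)) * indicator {x - K..x} y"
      proof (cases "y \<in> {x - K..x}")
        case True
        then have "v y \<le> 2 * v x" using x0[of y "x - y"] elim by auto
        moreover have "v y \<ge> 0" "u (x - y) \<ge> 0" "u (x - y) \<le> M"
          using slowly_varyingD(2)[OF u] slowly_varyingD(2)[OF v] True elim M by auto
        ultimately have "u (x - y) * v y \<le> M * (2 * v x)" by (intro mult_mono) (use M in auto)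
        then show ?thesis using True by (auto intro: ennreal_leI)
      qed auto
    qed
    also have "\<dots> = ennreal (M * (2 * v x)) * emeasure lborel {x - K..x}"
      by (simp add: nn_integral_cmult_indicator)
    also have "\<dots> = ennreal (c * v x)"
      using M slowly_varyingD(2)[OF v] elim
      by (cases "K \<ge> 0") (auto simp: c_def ennreal_mult[symmetric] mult_ac max_def)
    finally show ?case .
  qed
  then show ?thesis using M by (intro exI[of _ c]) (auto simp: c_def)
qed

lemma infinite_integral_unbounded:
  assumes [measurable]: "u \<in> borel_measurable borel" and inf: "infinite_integral u"
  shows "\<exists>N::nat. ennreal B \<le> (\<integral>\<^sup>+y\<in>{0..real N}. ennreal (u y) \<partial>lborel)"
proof -
  have "(SUP N. (\<integral>\<^sup>+y\<in>{0..real N}. ennreal (u y) \<partial>lborel)) = (\<integral>\<^sup>+y. (SUP N. ennreal (u y) * indicator {0..real N} y) \<partial>lborel)"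
    by (intro nn_integral_monotone_convergence_SUP[symmetric])
       (auto simp: incseq_def le_fun_def indicator_def)
  also have "\<dots> = (\<integral>\<^sup>+y\<in>{0..}. ennreal (u y) \<partial>lborel)"
  proof (intro nn_integral_cong antisym)
    fix y :: real
    show "(SUP N. ennreal (u y) * indicator {0..real N} y) \<le> ennreal (u y) * indicator {0..} y"
      by (intro SUP_least) (auto simp: indicator_def)
    obtain N :: nat where "y \<le> real N" using real_arch_simple by blast
    then show "ennreal (u y) * indicator {0..} y \<le> (SUP N. ennreal (u y) * indicator {0..real N} y)"
      by (intro SUP_upper2[of N]) (auto simp: indicator_def)
  qed
  finally have "(SUP N. (\<integral>\<^sup>+y\<in>{0..real N}. ennreal (u y) \<partial>lborel)) = \<infinity>"
    using inf by (simp add: infinite_integral_def)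
  then have "ennreal B < (SUP N. (\<integral>\<^sup>+y\<in>{0..real N}. ennreal (u y) \<partial>lborel))"
    by (simp only: infinity_ennreal_def ennreal_less_top)
  then show ?thesis by (auto simp: less_SUP_iff intro: less_imp_le)
qed

text \<open>Over \<open>[0, N]\<close> the values \<open>v (x - y)\<close> are eventually at least \<open>v x / 2\<close>, so the
  convolution is at least \<open>v x / 2\<close> times the integral of \<open>u\<close> over \<open>[0, N]\<close>, which is arbitrarily
  large. It is essential that the constant \<open>1 / 2\<close> does not depend on \<open>N\<close>.\<close>

lemma otimes_dominates:
  assumes u: "slowly_varying u" and v: "slowly_varying v" and inf: "infinite_integral u" and B: "B \<ge> 0"
  shows "\<forall>\<^sub>F x in at_top. B * v x \<le> otimes u v x"
proof -
  obtain N :: nat where N: "ennreal (2 * B) \<le> (\<integral>\<^sup>+y\<in>{0..real N}. ennreal (u y) \<partial>lborel)"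
    using infinite_integral_unbounded[OF slowly_varyingD(1)[OF u] inf] by blast
  have "\<exists>x0. \<forall>x\<ge>x0. \<forall>t\<in>{0..real N}. v (x + t) \<le> 2 * v x"
    using slowly_varying_uniform[OF v, of 1 "real N"] by (auto simp: eventually_at_top_linorder)
  then obtain x0 where x0: "\<And>x t. x \<ge> x0 \<Longrightarrow> t \<in> {0..real N} \<Longrightarrow> v (x + t) \<le> 2 * v x" by blast
  show ?thesis
    using eventually_ge_at_top[of "x0 + N"] eventually_ge_at_top[of "real N"]
  proof eventually_elim
    case (elim x)
    have vx: "v x \<ge> 0" using slowly_varyingD(2)[OF v] elim by auto
    note [measurable] = slowly_varyingD(1)[OF u] slowly_varyingD(1)[OF v]
    have "ennreal (B * v x) = ennreal (v x / 2) * ennreal (2 * B)"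
      using vx B by (simp flip: ennreal_mult)
    also have "\<dots> \<le> ennreal (v x / 2) * (\<integral>\<^sup>+y\<in>{0..real N}. ennreal (u y) \<partial>lborel)"
      by (intro mult_left_mono N) auto
    also have "\<dots> = (\<integral>\<^sup>+y. ennreal (v x / 2) * (ennreal (u y) * indicator {0..real N} y) \<partial>lborel)"
      by (subst nn_integral_cmult) auto
    \<comment> \<open>Restrict the convolution integral to \<open>[0, N]\<close>.\<close>
    also have "\<dots> \<le> (\<integral>\<^sup>+y\<in>{0..x}. ennreal (v (x - y) * u y) \<partial>lborel)"
    proof (intro nn_integral_mono)
      fix y
      show "ennreal (v x / 2) * (ennreal (u y) * indicator {0..real N} y) \<le> ennreal (v (x - y) * u y) * indicator {0..x} y"
      proof (cases "y \<in> {0..real N}")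
        case True
        then have "v x / 2 \<le> v (x - y)" using x0[of "x - y" y] elim by auto
        then have "v x / 2 * u y \<le> v (x - y) * u y" using slowly_varyingD(2)[OF u] True by (intro mult_right_mono) auto
        moreover have "ennreal (v x / 2) * ennreal (u y) = ennreal (v x / 2 * u y)"
          using vx slowly_varyingD(2)[OF u] True by (intro ennreal_mult[symmetric]) auto
        ultimately show ?thesis using True elim by (auto intro: ennreal_leI simp: indicator_def)
      qed auto
    qed
    also have "\<dots> = ennreal (otimes v u x)" by (rule otimes_eq_nn_integral[OF v u, symmetric])
    finally show ?case using otimes_nonneg[OF v u, of x] by (simp add: otimes_commute[of v u])
  qed
qed

text \<open>Away from the end where the argument of \<open>u\<close> is bounded, shifting \<open>x\<close> changes only the argument
  of \<open>u\<close>, hence the integrand by a factor close to 1; the end itself is of order \<open>v x\<close>, which is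
  negligible by \<open>otimes_dominates\<close>.\<close>

lemma slowly_varying_otimes:
  assumes u: "slowly_varying u" and v: "slowly_varying v" and inf: "infinite_integral u"
  shows "slowly_varying (otimes u v)"
  unfolding slowly_varying_def
proof (intro conjI allI impI)
  note [measurable] = slowly_varyingD(1)[OF u] slowly_varyingD(1)[OF v]
  note nn = slowly_varyingD(2)[OF u] slowly_varyingD(2)[OF v]
  have "(\<lambda>x. \<integral>y. indicator {p :: real \<times> real. 0 \<le> snd p \<and> snd p \<le> fst p} (x, y) *\<^sub>R (u (x - y) * v y) \<partial>lborel) \<in> borel_measurable borel"
    by measurable
  also have "(\<lambda>x. \<integral>y. indicator {p :: real \<times> real. 0 \<le> snd p \<and> snd p \<le> fst p} (x, y) *\<^sub>R (u (x - y) * v y) \<partial>lborel) = otimes u v"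
    unfolding otimes_def set_lebesgue_integral_def
    by (intro ext Bochner_Integration.integral_cong) (auto simp: indicator_def)
  finally show "otimes u v \<in> borel_measurable borel" .
  show "otimes u v x \<ge> 0" for x by (rule otimes_nonneg[OF u v])
  show "\<exists>M. \<forall>x\<in>{0..B}. otimes u v x \<le> M" for B
  proof -
    obtain M where M: "M \<ge> 0" "\<And>y. y \<in> {0..B} \<Longrightarrow> u y \<le> M" using slowly_varyingD(3)[OF u, of B] by auto
    obtain M' where M': "M' \<ge> 0" "\<And>y. y \<in> {0..B} \<Longrightarrow> v y \<le> M'" using slowly_varyingD(3)[OF v, of B] by auto
    have "otimes u v x \<le> M * M' * B" if x: "x \<in> {0..B}" for x
    proof -
      have "ennreal (otimes u v x) \<le> (\<integral>\<^sup>+y. ennreal (M * M') * indicator {0..x} y \<partial>lborel)"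
        unfolding otimes_eq_nn_integral[OF u v] using x
        by (intro nn_integral_mono) (auto simp: indicator_def intro!: ennreal_leI mult_mono M M' nn)
      also have "\<dots> = ennreal (M * M' * x)"
        using M M' x by (simp add: nn_integral_cmult_indicator flip: ennreal_mult)
      finally have "otimes u v x \<le> M * M' * x" using M M' x by simp
      also have "\<dots> \<le> M * M' * B" using M M' x by (intro mult_left_mono) auto
      finally show ?thesis .
    qed
    then show ?thesis by blast
  qed
  show "\<forall>\<^sub>F x in at_top. otimes u v x > 0"
    using otimes_dominates[OF u v inf, of 1, simplified] slowly_varyingD(4)[OF v] by eventually_elim auto
  fix e :: real assume e: "e > 0"
  \<comment> \<open>The main part costs \<open>1 + d\<close> and the end costs \<open>d\<close>; the lower bound uses \<open>(1 + d) / (1 - d) \<le> 1 + 5 d\<close>.\<close>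
  define d where "d = min (1/2) (e / 5)"
  have d: "d > 0" "d \<le> 1 / 2" "5 * d \<le> e" using e by (auto simp: d_def)
  have "\<exists>K\<ge>0. \<forall>x\<ge>K. \<forall>t\<in>{0..1}. u (x + t) \<le> (1 + d) * u x \<and> u x \<le> (1 + d) * u (x + t)"
  proof -
    obtain K where "\<forall>x\<ge>K. \<forall>t\<in>{0..1}. u (x + t) \<le> (1 + d) * u x \<and> u x \<le> (1 + d) * u (x + t)"
      using slowly_varyingD(5)[OF u d(1)] by (auto simp: eventually_at_top_linorder)
    then show ?thesis by (intro exI[of _ "max K 0"]) auto
  qed
  then obtain K where K: "K \<ge> 0" "\<And>x t. x \<ge> K \<Longrightarrow> t \<in> {0..1} \<Longrightarrow> u (x + t) \<le> (1 + d) * u x"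
      "\<And>x t. x \<ge> K \<Longrightarrow> t \<in> {0..1} \<Longrightarrow> u x \<le> (1 + d) * u (x + t)" by blast
  obtain c where c: "c \<ge> 0" and edge: "\<forall>\<^sub>F x in at_top.
    (\<integral>\<^sup>+y\<in>{x - (K + 1)..x}. ennreal (u (x - y) * v y) \<partial>lborel) \<le> ennreal (c * v x)"
    using otimes_edge_le[OF u v] by blast
  have "\<forall>\<^sub>F x in at_top. 2 * c / d * v x \<le> otimes u v x" using d c by (intro otimes_dominates[OF u v inf]) auto
  then have "\<forall>\<^sub>F x in at_top. (\<integral>\<^sup>+y\<in>{x - (K + 1)..x}. ennreal (u (x - y) * v y) \<partial>lborel) \<le> ennreal (c * v x) \<and>
     2 * c * v x \<le> d * otimes u v x \<and> (\<forall>t\<in>{0..1}. v (x + t) \<le> 2 * v x) \<and> x \<ge> K"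
    using edge slowly_varyingD(5)[OF v, of 1, simplified] eventually_ge_at_top[of K]
    by eventually_elim (use d in \<open>auto simp: field_simps\<close>)
  then obtain x0 where x0: "\<And>x. x \<ge> x0 \<Longrightarrow> (\<integral>\<^sup>+y\<in>{x - (K + 1)..x}. ennreal (u (x - y) * v y) \<partial>lborel) \<le> ennreal (c * v x) \<and>
     2 * c * v x \<le> d * otimes u v x \<and> (\<forall>t\<in>{0..1}. v (x + t) \<le> 2 * v x) \<and> x \<ge> K"
    unfolding eventually_at_top_linorder by blast
  show "\<forall>\<^sub>F x in at_top. \<forall>t\<in>{0..1}. otimes u v (x + t) \<le> (1 + e) * otimes u v x \<and> otimes u v x \<le> (1 + e) * otimes u v (x + t)"
    using eventually_ge_at_top[of x0]
  proof eventually_elim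
    case (elim x)
    define w where "w = otimes u v"
    have w0: "w z \<ge> 0" for z by (simp add: w_def otimes_nonneg[OF u v])
    note nw = otimes_eq_nn_integral[OF u v, folded w_def]
    have xK: "x \<ge> K" using x0[OF elim] by blast
    show ?case unfolding w_def[symmetric]
    proof
      fix t :: real assume t: "t \<in> {0..1}"
      have xt: "x + t \<ge> x0" using elim t by auto
      have v0: "v x \<ge> 0" "v (x + t) \<ge> 0" using nn xK K t by auto
      have "ennreal (w (x + t)) = (\<integral>\<^sup>+y\<in>{0..x + t}. ennreal (u (x + t - y) * v y) \<partial>lborel)" by (rule nw)
      also have "\<dots> \<le> (\<integral>\<^sup>+y. ennreal (1 + d) * (ennreal (u (x - y) * v y) * indicator {0..x} y) +
           ennreal (u (x + t - y) * v y) * indicator {x + t - (K + 1)..x + t} y \<partial>lborel)"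
      proof (intro nn_integral_mono)
        fix y
        show "ennreal (u (x + t - y) * v y) * indicator {0..x + t} y \<le> ennreal (1 + d) * (ennreal (u (x - y) * v y) * indicator {0..x} y) +
           ennreal (u (x + t - y) * v y) * indicator {x + t - (K + 1)..x + t} y"
        proof (cases "y \<in> {0..x - K}")
          case True
          then have "u (x + t - y) \<le> (1 + d) * u (x - y)"
            using K(2)[of "x - y" t] t by (simp add: algebra_simps)
          then have "u (x + t - y) * v y \<le> (1 + d) * (u (x - y) * v y)"
            using mult_right_mono nn True by (force simp: mult.assoc[symmetric])
          then have "ennreal (u (x + t - y) * v y) \<le> ennreal (1 + d) * ennreal (u (x - y) * v y)"
            using d nn True K by (subst ennreal_mult[symmetric]) (auto intro!: ennreal_leI)
          then show ?thesis using True K t by (auto simp: indicator_def intro: order_trans)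
        qed (use t in \<open>auto simp: indicator_def\<close>)
      qed
      also have "\<dots> = ennreal (1 + d) * ennreal (w x) + (\<integral>\<^sup>+y\<in>{x + t - (K + 1)..x + t}. ennreal (u (x + t - y) * v y) \<partial>lborel)"
        by (subst nn_integral_add) (auto simp: nn_integral_cmult nw)
      also have "\<dots> \<le> ennreal (1 + d) * ennreal (w x) + ennreal (c * v (x + t))"
        by (intro add_left_mono) (use x0[OF xt] in blast)
      also have "\<dots> = ennreal ((1 + d) * w x + c * v (x + t))"
        using d w0 c v0 by (simp add: ennreal_mult)
      finally have 1: "w (x + t) \<le> (1 + d) * w x + c * v (x + t)"
        using d w0 c v0 by (simp add: ennreal_le_iff del: ennreal_plus)
      have "c * v (x + t) \<le> c * (2 * v x)" using x0[OF elim] t c by (intro mult_left_mono) auto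
      also have "\<dots> \<le> d * w x" using x0[OF elim] unfolding w_def by auto
      finally have "w (x + t) \<le> (1 + 2 * d) * w x" using 1 by (auto simp: algebra_simps)
      also have "\<dots> \<le> (1 + e) * w x" using d w0 by (intro mult_right_mono) auto
      finally have A: "w (x + t) \<le> (1 + e) * w x" .
      have "ennreal (w x) = (\<integral>\<^sup>+y\<in>{0..x}. ennreal (u (x - y) * v y) \<partial>lborel)" by (rule nw)
      also have "\<dots> \<le> (\<integral>\<^sup>+y. ennreal (1 + d) * (ennreal (u (x + t - y) * v y) * indicator {0..x + t} y) +
           ennreal (u (x - y) * v y) * indicator {x - (K + 1)..x} y \<partial>lborel)"
      proof (intro nn_integral_mono)
        fix y
        show "ennreal (u (x - y) * v y) * indicator {0..x} y \<le> ennreal (1 + d) * (ennreal (u (x + t - y) * v y) * indicator {0..x + t} y) +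
           ennreal (u (x - y) * v y) * indicator {x - (K + 1)..x} y"
        proof (cases "y \<in> {0..x - K}")
          case True
          then have "u (x - y) \<le> (1 + d) * u (x + t - y)"
            using K(3)[of "x - y" t] t by (simp add: algebra_simps)
          then have "u (x - y) * v y \<le> (1 + d) * (u (x + t - y) * v y)"
            using mult_right_mono nn True by (force simp: mult.assoc[symmetric])
          then have "ennreal (u (x - y) * v y) \<le> ennreal (1 + d) * ennreal (u (x + t - y) * v y)"
            using d nn True K t by (subst ennreal_mult[symmetric]) (auto intro!: ennreal_leI)
          then show ?thesis using True K t by (auto simp: indicator_def intro: order_trans)
        qed (use t in \<open>auto simp: indicator_def\<close>)
      qed
      also have "\<dots> = ennreal (1 + d) * ennreal (w (x + t)) + (\<integral>\<^sup>+y\<in>{x - (K + 1)..x}. ennreal (u (x - y) * v y) \<partial>lborel)"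
        by (subst nn_integral_add) (auto simp: nn_integral_cmult nw)
      also have "\<dots> \<le> ennreal (1 + d) * ennreal (w (x + t)) + ennreal (c * v x)"
        by (intro add_left_mono) (use x0[OF elim] in blast)
      also have "\<dots> = ennreal ((1 + d) * w (x + t) + c * v x)"
        using d w0 c v0 by (simp add: ennreal_mult)
      finally have 2: "w x \<le> (1 + d) * w (x + t) + c * v x"
        using d w0 c v0 by (simp add: ennreal_le_iff del: ennreal_plus)
      have "c * v x \<le> d * w x" using x0[OF elim] w0[of x] c v0 unfolding w_def[symmetric]
        by (metis (no_types, opaque_lifting) mult.assoc mult_2 add_increasing mult_nonneg_nonneg order_trans order_refl)
      then have "(1 - d) * w x \<le> (1 + d) * w (x + t)" using 2 by (auto simp: algebra_simps)
      moreover have "(1 + d) \<le> (1 + 5 * d) * (1 - d)"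
      proof -
        have "d * d \<le> d * (1 / 2)" using d by (intro mult_left_mono) auto
        then show ?thesis using d by (simp add: algebra_simps)
      qed
      ultimately have "(1 - d) * w x \<le> (1 - d) * ((1 + 5 * d) * w (x + t))"
        using mult_right_mono[of "1 + d" "(1 + 5 * d) * (1 - d)" "w (x + t)"] w0[of "x + t"] by (simp add: mult_ac)
      then have "w x \<le> (1 + 5 * d) * w (x + t)" using d by (simp add: mult_le_cancel_left)
      also have "\<dots> \<le> (1 + e) * w (x + t)" using d w0 by (intro mult_right_mono) auto
      finally show "w (x + t) \<le> (1 + e) * w x \<and> w x \<le> (1 + e) * w (x + t)" using A by blast
    qed
  qed
qed

lemma infinite_integral_mono:
  assumes u: "u \<in> borel_measurable borel" and bdd: "\<And>B. \<exists>M\<ge>0. \<forall>x\<in>{0..B}. u x \<le> M"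
    and v: "v \<in> borel_measurable borel" and inf: "infinite_integral u" and c: "c > 0"
    and le: "\<forall>\<^sub>F x in at_top. u x \<le> c * v x"
  shows "infinite_integral v"
proof -
  note [measurable] = u v
  obtain K where K: "K \<ge> 0" "\<And>x. x \<ge> K \<Longrightarrow> u x \<le> c * v x"
  proof -
    obtain K where "\<forall>x\<ge>K. u x \<le> c * v x" using le by (auto simp: eventually_at_top_linorder)
    then show ?thesis by (intro that[of "max K 0"]) auto
  qed
  obtain M where M: "M \<ge> 0" "\<And>y. y \<in> {0..K} \<Longrightarrow> u y \<le> M" using bdd[of K] by auto
  have "(\<integral>\<^sup>+y\<in>{0..}. ennreal (u y) \<partial>lborel) \<le>
      (\<integral>\<^sup>+y. ennreal M * indicator {0..K} y + ennreal c * (ennreal (v y) * indicator {0..} y) \<partial>lborel)"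
  proof (intro nn_integral_mono)
    fix y
    show "ennreal (u y) * indicator {0..} y \<le> ennreal M * indicator {0..K} y + ennreal c * (ennreal (v y) * indicator {0..} y)"
    proof (cases "y \<le> K")
      case True
      then show ?thesis using M by (auto simp: indicator_def intro!: ennreal_leI add_increasing2)
    next
      case False
      then show ?thesis using K c by (auto simp: indicator_def ennreal_mult'[symmetric] intro!: ennreal_leI)
    qed
  qed
  also have "\<dots> = ennreal M * ennreal K + ennreal c * (\<integral>\<^sup>+y\<in>{0..}. ennreal (v y) \<partial>lborel)"
    using K by (subst nn_integral_add) (auto simp: nn_integral_cmult)
  finally have "ennreal M * ennreal K + ennreal c * (\<integral>\<^sup>+y\<in>{0..}. ennreal (v y) \<partial>lborel) = \<infinity>"
    using inf by (simp add: infinite_integral_def top_unique)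
  then show ?thesis by (auto simp: infinite_integral_def ennreal_mult_eq_top_iff)
qed

lemma infinite_integral_otimes:
  assumes u: "slowly_varying u" and v: "slowly_varying v" and "infinite_integral u" "infinite_integral v"
  shows "infinite_integral (otimes u v)"
  by (rule infinite_integral_mono[OF slowly_varyingD(1)[OF v] slowly_varyingD(3)[OF v], where c = 1])
     (use assms otimes_dominates[OF u v, of 1, simplified] slowly_varyingD(1)[OF slowly_varying_otimes[OF u v]] in auto)

section \<open>Limits along the real numbers or along the integers\<close>

text \<open>The filter of arguments tending to infinity within \<open>S\<close>; \<open>S\<close> is the whole line or the set of
  integers.\<close>

definition along :: "real set \<Rightarrow> real filter" where
  "along S = inf at_top (principal S)"

lemma eventually_along: "eventually P (along S) \<longleftrightarrow> (\<forall>\<^sub>F x in at_top. x \<in> S \<longrightarrow> P x)"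
  by (simp add: along_def eventually_inf_principal)

lemma along_UNIV [simp]: "along UNIV = at_top"
  by (simp add: along_def)

lemma along_mono: "S \<subseteq> T \<Longrightarrow> along S \<le> along T"
  by (auto simp: along_def intro: le_infI2)

lemma asymp_equiv_filter_mono: "F \<le> G \<Longrightarrow> f \<sim>[G] g \<Longrightarrow> f \<sim>[F] g"
  unfolding asymp_equiv_def by (rule tendsto_mono)

lemma along_le_at_top: "along S \<le> at_top"
  by (simp add: along_def)

lemma eventually_in_along: "\<forall>\<^sub>F x in along S. x \<in> S"
  by (simp add: eventually_along)

lemma along_Ints: "along \<int> = filtermap real sequentially"
proof (rule filter_eq_iff[THEN iffD2], intro allI iffI)
  fix P assume "eventually P (along \<int>)"
  then obtain N where N: "\<And>x. x \<ge> N \<Longrightarrow> x \<in> \<int> \<Longrightarrow> P x"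
    by (auto simp: eventually_along eventually_at_top_linorder)
  obtain n :: nat where "N \<le> real n" using real_arch_simple by blast
  then show "eventually P (filtermap real sequentially)"
    by (auto simp: eventually_filtermap eventually_at_top_linorder intro!: exI[of _ n] N)
next
  fix P assume "eventually P (filtermap real sequentially)"
  then obtain N where N: "\<And>n. n \<ge> N \<Longrightarrow> P (real n)"
    by (auto simp: eventually_filtermap eventually_at_top_linorder)
  have "P x" if "x \<ge> real N" "x \<in> \<int>" for x
  proof -
    have "x \<in> \<nat>" using that by (simp add: Nats_altdef2)
    then show ?thesis using N that by (auto elim!: Nats_cases)
  qed
  then show "eventually P (along \<int>)"
    by (auto simp: eventually_along eventually_at_top_linorder intro!: exI[of _ "real N"])
qed

text \<open>Integrating \<open>h (round_down S y)\<close> over \<open>y\<close> is integration of \<open>h\<close> if \<open>S\<close> is the real line, and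
  summation of \<open>h\<close> over the integers if \<open>S = \<int>\<close>.\<close>

definition round_down :: "real set \<Rightarrow> real \<Rightarrow> real" where
  "round_down S y = (if S = UNIV then y else of_int \<lfloor>y\<rfloor>)"

lemma Ints_neq_UNIV [simp]: "(\<int> :: real set) \<noteq> UNIV"
proof
  assume "(\<int> :: real set) = UNIV"
  then have "(1/2 :: real) \<in> \<int>" by blast
  then obtain k where "(1/2 :: real) = of_int k" by (auto elim: Ints_cases)
  then have "1 = real_of_int (2 * k)" by simp
  then have "1 = 2 * k" by (simp only: of_int_eq_1_iff[symmetric])
  then show False by presburger
qed

lemma not_UNIV_subset_Ints [simp]: "\<not> UNIV \<subseteq> (\<int> :: real set)"
  using Ints_neq_UNIV by blast

lemma round_down:
  assumes "S \<in> {UNIV, \<int>}"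
  shows "round_down S y \<le> y" "y - 1 \<le> round_down S y" "round_down S y \<in> S"
  using assms by (auto simp: round_down_def)

lemma round_down_measurable [measurable]: "round_down S \<in> borel_measurable borel"
proof -
  have "mono (round_down S)"
    by (auto simp: mono_def round_down_def floor_mono)
  then show ?thesis by (rule borel_measurable_mono)
qed

section \<open>Tails compared with slowly varying functions\<close>

lemma asymp_equiv_ratio_bounds:
  fixes f g :: "'a \<Rightarrow> real"
  assumes "f \<sim>[F] g" "e > 0" "\<forall>\<^sub>F x in F. f x \<ge> 0" "\<forall>\<^sub>F x in F. g x \<ge> 0"
  shows "\<forall>\<^sub>F x in F. f x \<le> (1 + e) * g x \<and> g x \<le> (1 + e) * f x"
proof -
  have "\<forall>\<^sub>F x in F. norm (f x) \<le> (1 + e) * norm (g x)" "\<forall>\<^sub>F x in F. norm (g x) \<le> (1 + e) * norm (f x)"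
    using asymp_equiv_imp_eventually_le[OF assms(1), of "1 + e"]
      asymp_equiv_imp_eventually_le[OF asymp_equiv_symI[OF assms(1)], of "1 + e"] assms(2) by auto
  then show ?thesis using assms(3,4) by eventually_elim auto
qed

lemma tail_antimono: "real_distribution V \<Longrightarrow> x \<le> y \<Longrightarrow> tail V y \<le> tail V x"
  by (simp add: tail_def finite_borel_measure.cdf_nondecreasing real_distribution.finite_borel_measure_M)

lemma tail_nonneg: "real_distribution V \<Longrightarrow> tail V x \<ge> 0"
  by (simp add: tail_def real_distribution.cdf_bounded_prob)

lemma tail_le_1: "real_distribution V \<Longrightarrow> tail V x \<le> 1"
  by (simp add: tail_def real_distribution.finite_borel_measure_M finite_borel_measure.cdf_nonneg)

lemma tail_measurable [measurable]:
  assumes "real_distribution V" shows "tail V \<in> borel_measurable borel"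
proof -
  have "mono (\<lambda>x. - tail V x)" using tail_antimono[OF assms] by (auto simp: mono_def)
  then have "(\<lambda>x. - (- tail V x)) \<in> borel_measurable borel"
    using borel_measurable_mono borel_measurable_uminus by blast
  then show ?thesis by simp
qed

lemma emeasure_greaterThan_tail:
  assumes "real_distribution V" shows "emeasure V {x<..} = ennreal (tail V x)"
proof -
  interpret real_distribution V by fact
  have "measure V (UNIV - {..x}) = 1 - measure V {..x}"
    using prob_compl[of "{..x}"] by simp
  moreover have "UNIV - {..x} = {x<..}" by auto
  ultimately show ?thesis by (simp add: tail_def cdf_def emeasure_eq_measure)
qed

lemma tail_ratio_bounds:
  assumes "real_distribution V" "slowly_varying u" "tail V \<sim>[along S] (\<lambda>x. exp (- \<alpha> * x) * u x)" "e > 0"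
  shows "\<forall>\<^sub>F x in along S. tail V x \<le> (1 + e) * (exp (- \<alpha> * x) * u x) \<and> exp (- \<alpha> * x) * u x \<le> (1 + e) * tail V x"
proof (rule asymp_equiv_ratio_bounds[OF assms(3,4)])
  show "\<forall>\<^sub>F x in along S. exp (- \<alpha> * x) * u x \<ge> 0"
    using filter_leD[OF along_le_at_top slowly_varyingD(4)[OF assms(2)]] by eventually_elim simp
qed (simp add: tail_nonneg assms(1))

text \<open>Even if the equivalence holds only along the integers, monotonicity of the tail gives an upper
  bound of the right order along all real arguments.\<close>

lemma real_tail_bound:
  assumes V: "real_distribution V" and u: "slowly_varying u" and S: "S \<in> {UNIV, \<int>}"
    and tl: "tail V \<sim>[along S] (\<lambda>x. exp (- \<alpha> * x) * u x)" and "\<alpha> > 0"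
  shows "\<exists>c>0. \<forall>\<^sub>F x in at_top. tail V x \<le> c * (exp (- \<alpha> * x) * u x)"
proof -
  have "\<forall>\<^sub>F x in along S. tail V x \<le> (1 + 1) * (exp (- \<alpha> * x) * u x) \<and> exp (- \<alpha> * x) * u x \<le> (1 + 1) * tail V x"
    by (rule tail_ratio_bounds[OF V u tl]) simp
  then have "\<forall>\<^sub>F x in at_top. (x \<in> S \<longrightarrow> tail V x \<le> 2 * (exp (- \<alpha> * x) * u x)) \<and> x \<ge> 0 \<and>
     (\<forall>t\<in>{0..1}. u x \<le> 2 * u (x + t))"
    unfolding eventually_along using slowly_varyingD(5)[OF u, of 1, simplified] eventually_ge_at_top[of 0]
    by eventually_elim auto
  then obtain x0 where x0: "\<And>x. x \<ge> x0 \<Longrightarrow> (x \<in> S \<longrightarrow> tail V x \<le> 2 * (exp (- \<alpha> * x) * u x)) \<and> x \<ge> 0 \<and>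
     (\<forall>t\<in>{0..1}. u x \<le> 2 * u (x + t))" by (auto simp: eventually_at_top_linorder)
  have "tail V x \<le> 4 * exp \<alpha> * (exp (- \<alpha> * x) * u x)" if x: "x \<ge> x0 + 1" for x
  proof -
    define y where "y = round_down S x"
    have y: "y \<le> x" "x - 1 \<le> y" "y \<in> S" using round_down[OF S] by (auto simp: y_def)
    have "\<forall>t\<in>{0..1}. u y \<le> 2 * u (y + t)" using x0[of y] y x by auto
    moreover have "x - y \<in> {0..1}" using y by auto
    ultimately have "u y \<le> 2 * u (y + (x - y))" by blast
    then have uy: "u y \<le> 2 * u x" by simp
    have "exp (- \<alpha> * y) \<le> exp (\<alpha> + (- \<alpha> * x))" using mult_left_mono[OF y(2), of \<alpha>] assms(5)
      by (simp add: algebra_simps)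
    then have ey: "exp (- \<alpha> * y) \<le> exp \<alpha> * exp (- \<alpha> * x)" by (simp only: exp_add)
    have "tail V x \<le> tail V y" by (rule tail_antimono[OF V y(1)])
    also have "\<dots> \<le> 2 * (exp (- \<alpha> * y) * u y)" using x0[of y] y x by auto
    also have "\<dots> \<le> 2 * (exp \<alpha> * exp (- \<alpha> * x) * (2 * u x))"
      using uy ey slowly_varyingD(2)[OF u, of y] x0[of y] x y by (intro mult_left_mono mult_mono) auto
    finally show ?thesis by (simp add: mult_ac)
  qed
  then show ?thesis
    by (intro exI[of _ "4 * exp \<alpha>"]) (auto simp: eventually_at_top_linorder)
qed

lemma tail_integral_bound:
  assumes V: "real_distribution V" and u: "slowly_varying u" and S: "S \<in> {UNIV, \<int>}"
    and tl: "tail V \<sim>[along S] (\<lambda>x. exp (- \<alpha> * x) * u x)" and \<alpha>: "\<alpha> > 0" and K: "K \<ge> 0"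
  shows "\<exists>c>0. \<forall>\<^sub>F x in at_top. (\<integral>\<^sup>+s\<in>{x - K..}. ennreal (tail V s) \<partial>lborel) \<le> ennreal (c * (exp (- \<alpha> * x) * u x))"
proof -
  obtain c1 where c1: "c1 > 0" "\<forall>\<^sub>F x in at_top. tail V x \<le> c1 * (exp (- \<alpha> * x) * u x)"
    using real_tail_bound[OF V u S tl \<alpha>] by blast
  obtain x1 where x1: "\<And>x. x \<ge> x1 \<Longrightarrow> tail V x \<le> c1 * (exp (- \<alpha> * x) * u x)"
    using c1(2) by (auto simp: eventually_at_top_linorder)
  define r where "r = \<alpha> / 2"
  have r: "r > 0" "\<alpha> = 2 * r" using \<alpha> by (auto simp: r_def)
  obtain x2 where x2: "x2 \<ge> 0" "\<And>x t. x \<ge> x2 \<Longrightarrow> t \<ge> 0 \<Longrightarrow> u (x + t) \<le> exp (r * (t + 1)) * u x"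
    using slowly_varying_subexponential[OF u r(1)] by blast
  have "\<exists>x3. \<forall>x\<ge>x3. \<forall>t\<in>{0..K}. u x \<le> 2 * u (x + t)"
    using slowly_varying_uniform[OF u, of 1 K] by (auto simp: eventually_at_top_linorder)
  then obtain x3 where x3: "\<And>x t. x \<ge> x3 \<Longrightarrow> t \<in> {0..K} \<Longrightarrow> u x \<le> 2 * u (x + t)" by blast
  \<comment> \<open>Half of the exponential rate, \<open>r = \<alpha> / 2\<close>, absorbs the growth of \<open>u\<close>; integrating the other half gives \<open>1 / r\<close>.\<close>
  define c where "c = 2 * c1 * exp r / r * exp (2 * r * K)"
  have bound: "(\<integral>\<^sup>+s\<in>{x - K..}. ennreal (tail V s) \<partial>lborel) \<le> ennreal (c * (exp (- \<alpha> * x) * u x))"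
    if x: "x \<ge> max x1 (max x2 x3) + K" for x
  proof -
    define z where "z = x - K"
    have z: "z \<ge> x1" "z \<ge> x2" "z \<ge> x3" "z \<ge> 0" using x x2(1) by (auto simp: z_def)
    have uz: "u z \<ge> 0" using slowly_varyingD(2)[OF u] z by auto
    have "(\<integral>\<^sup>+s\<in>{z..}. ennreal (tail V s) \<partial>lborel) \<le>
       (\<integral>\<^sup>+s. ennreal (c1 * u z * exp (r - r * z)) * (ennreal (exp (- r * s)) * indicator {z..} s) \<partial>lborel)"
    proof (intro nn_integral_mono)
      fix s
      have "tail V s \<le> c1 * u z * exp (r - r * z) * exp (- r * s)" if s: "s \<ge> z"
      proof -
        have "tail V s \<le> c1 * (exp (- \<alpha> * s) * u (z + (s - z)))" using x1[of s] s z by simp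
        also have "\<dots> \<le> c1 * (exp (- \<alpha> * s) * (exp (r * ((s - z) + 1)) * u z))"
          using c1 s z x2(2)[of z "s - z"] by (intro mult_left_mono) auto
        also have "exp (- \<alpha> * s) * (exp (r * ((s - z) + 1)) * u z) = exp (- \<alpha> * s + r * ((s - z) + 1)) * u z"
          by (simp only: exp_add mult.assoc)
        also have "- \<alpha> * s + r * ((s - z) + 1) = (r - r * z) + (- r * s)"
          by (simp add: r algebra_simps)
        finally show ?thesis by (simp only: exp_add mult_ac)
      qed
      then show "ennreal (tail V s) * indicator {z..} s \<le> ennreal (c1 * u z * exp (r - r * z)) * (ennreal (exp (- r * s)) * indicator {z..} s)"
        using c1 uz by (auto simp: indicator_def ennreal_mult[symmetric] intro!: ennreal_leI)
    qed
    also have "\<dots> = ennreal (c1 * u z * exp (r - r * z)) * (\<integral>\<^sup>+s. ennreal (exp (- r * s)) * indicator {z..} s \<partial>lborel)"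
      by (intro nn_integral_cmult) auto
    also have "(\<integral>\<^sup>+s. ennreal (exp (- r * s)) * indicator {z..} s \<partial>lborel) = ennreal (0 - (- exp (- r * z) / r))"
    proof (rule nn_integral_FTC_atLeast)
      show "((\<lambda>s. - exp (- r * s) / r) \<longlongrightarrow> 0) at_top" using r by real_asymp
    qed (use r in \<open>auto intro!: derivative_eq_intros\<close>)
    also have "ennreal (c1 * u z * exp (r - r * z)) * ennreal (0 - (- exp (- r * z) / r)) = ennreal (c1 * u z * exp r / r * exp (- \<alpha> * z))"
      using r c1 uz by (auto simp: ennreal_mult'[symmetric] exp_add[symmetric] exp_diff exp_minus field_simps mult_exp_exp intro!: arg_cong[where f = ennreal])
    also have "\<dots> \<le> ennreal (c * (exp (- \<alpha> * x) * u x))"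
    proof (rule ennreal_leI)
      have "u z \<le> 2 * u (z + K)" using x3[of z K] z K by auto
      then have "c1 * u z * exp r / r * exp (- \<alpha> * z) \<le> c1 * (2 * u x) * exp r / r * exp (- \<alpha> * z)"
        using c1 r by (intro mult_right_mono divide_right_mono mult_left_mono) (auto simp: z_def)
      moreover have "exp (- (\<alpha> * z)) = exp (2 * r * K) * exp (- (\<alpha> * x))"
        by (simp add: exp_add[symmetric] z_def r algebra_simps)
      ultimately show "c1 * u z * exp r / r * exp (- \<alpha> * z) \<le> c * (exp (- \<alpha> * x) * u x)"
        by (simp add: c_def mult_ac)
    qed
    finally show ?thesis by (simp add: z_def)
  qed
  have "c > 0" using c1 r by (simp add: c_def)
  then show ?thesis using bound unfolding eventually_at_top_linorder by blast
qed

section \<open>The integral of a product of two tails\<close>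

text \<open>The left-hand side of the identity explained at the beginning; \<open>S\<close> is the real line or, if
  \<open>V\<close> is concentrated on the integers, the set of integers.\<close>

definition tail_product_integral :: "real set \<Rightarrow> real measure \<Rightarrow> real measure \<Rightarrow> real \<Rightarrow> ennreal" where
  "tail_product_integral S V W x = (\<integral>\<^sup>+y. ennreal (tail V (round_down S y) * tail W (x - round_down S y)) \<partial>lborel)"

context
  fixes \<alpha> :: real and V W :: "real measure" and u v :: "real \<Rightarrow> real" and S T :: "real set"
  assumes \<alpha>: "\<alpha> > 0"
    and V: "real_distribution V" and W: "real_distribution W"
    and u: "slowly_varying u" and v: "slowly_varying v"
    and inf: "infinite_integral u" "infinite_integral v"
    and S: "S \<in> {UNIV, \<int>}" and T: "T \<in> {UNIV, \<int>}" and ST: "S \<subseteq> T"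
    and tV: "tail V \<sim>[along S] (\<lambda>x. exp (- \<alpha> * x) * u x)"
    and tW: "tail W \<sim>[along T] (\<lambda>x. exp (- \<alpha> * x) * v x)"
begin

text \<open>Each of the two tails and each of the two shifts by at most 1 caused by rounding costs a factor
  \<open>1 + d\<close>; this explains the fourth power.\<close>

lemma middle_comparison:
  assumes d: "d > 0"
  shows "\<exists>K\<ge>0. \<forall>x\<in>T. \<forall>y\<in>{K + 1..x - K}.
    tail V (round_down S y) * tail W (x - round_down S y) \<le> (1 + d) ^ 4 * (exp (- \<alpha> * x) * (v (x - y) * u y)) \<and>
    exp (- \<alpha> * x) * (v (x - y) * u y) \<le> (1 + d) ^ 4 * (tail V (round_down S y) * tail W (x - round_down S y))"
proof -
  define q where "q = 1 + d"
  have q: "q > 0" using d by (simp add: q_def)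
  have "\<forall>\<^sub>F x in along S. tail V x \<le> q * (exp (- \<alpha> * x) * u x) \<and> exp (- \<alpha> * x) * u x \<le> q * tail V x"
    unfolding q_def by (rule tail_ratio_bounds[OF V u tV d])
  moreover have "\<forall>\<^sub>F x in along T. tail W x \<le> q * (exp (- \<alpha> * x) * v x) \<and> exp (- \<alpha> * x) * v x \<le> q * tail W x"
    unfolding q_def by (rule tail_ratio_bounds[OF W v tW d])
  ultimately have "\<forall>\<^sub>F x in at_top. (x \<in> S \<longrightarrow> tail V x \<le> q * (exp (- \<alpha> * x) * u x) \<and> exp (- \<alpha> * x) * u x \<le> q * tail V x) \<and>
     (x \<in> T \<longrightarrow> tail W x \<le> q * (exp (- \<alpha> * x) * v x) \<and> exp (- \<alpha> * x) * v x \<le> q * tail W x) \<and>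
     (\<forall>t\<in>{0..1}. u (x + t) \<le> q * u x \<and> u x \<le> q * u (x + t)) \<and> (\<forall>t\<in>{0..1}. v (x + t) \<le> q * v x \<and> v x \<le> q * v (x + t))"
    unfolding eventually_along q_def using slowly_varyingD(5)[OF u d] slowly_varyingD(5)[OF v d]
    by eventually_elim auto
  then obtain K0 where K0: "\<And>x. x \<ge> K0 \<Longrightarrow> (x \<in> S \<longrightarrow> tail V x \<le> q * (exp (- \<alpha> * x) * u x) \<and> exp (- \<alpha> * x) * u x \<le> q * tail V x) \<and>
     (x \<in> T \<longrightarrow> tail W x \<le> q * (exp (- \<alpha> * x) * v x) \<and> exp (- \<alpha> * x) * v x \<le> q * tail W x) \<and>
     (\<forall>t\<in>{0..1}. u (x + t) \<le> q * u x \<and> u x \<le> q * u (x + t)) \<and> (\<forall>t\<in>{0..1}. v (x + t) \<le> q * v x \<and> v x \<le> q * v (x + t))"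
    unfolding eventually_at_top_linorder by blast
  define K where "K = max K0 0"
  note nn = slowly_varyingD(2)[OF u] slowly_varyingD(2)[OF v] tail_nonneg[OF V] tail_nonneg[OF W]
  have main: "tail V (round_down S y) * tail W (x - round_down S y) \<le> q ^ 4 * (exp (- \<alpha> * x) * (v (x - y) * u y)) \<and>
    exp (- \<alpha> * x) * (v (x - y) * u y) \<le> q ^ 4 * (tail V (round_down S y) * tail W (x - round_down S y))"
    if x: "x \<in> T" and y: "y \<in> {K + 1..x - K}" for x y
  proof -
    define a where "a = round_down S y"
    define b where "b = x - a"
    have a: "a \<in> S" "a \<ge> K0" "a \<ge> 0" "a \<le> y" "y - a \<in> {0..1}" using round_down[OF S, of y] y by (auto simp: a_def K_def)
    have b: "b \<in> T" "b \<ge> K0" "b \<ge> 0" "x - y \<ge> K0" "x - y \<ge> 0"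
      using T ST a x y by (auto simp: b_def K_def)
    have V1: "tail V a \<le> q * (exp (- \<alpha> * a) * u a)" "exp (- \<alpha> * a) * u a \<le> q * tail V a" using K0[OF a(2)] a by auto
    have W1: "tail W b \<le> q * (exp (- \<alpha> * b) * v b)" "exp (- \<alpha> * b) * v b \<le> q * tail W b" using K0[OF b(2)] b by auto
    have "u (a + (y - a)) \<le> q * u a \<and> u a \<le> q * u (a + (y - a))" using K0[OF a(2)] a(5) by blast
    then have u1: "u y \<le> q * u a" "u a \<le> q * u y" by auto
    have "v (x - y + (y - a)) \<le> q * v (x - y) \<and> v (x - y) \<le> q * v (x - y + (y - a))" using K0[OF b(4)] a(5) by blast
    then have v1: "v b \<le> q * v (x - y)" "v (x - y) \<le> q * v b" by (auto simp: b_def)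
    have nn': "0 \<le> u a" "0 \<le> u y" "0 \<le> v b" "0 \<le> v (x - y)" using a b nn by auto
    have ee: "exp (- \<alpha> * x) = exp (- \<alpha> * a) * exp (- \<alpha> * b)"
      by (simp add: b_def exp_add[symmetric] algebra_simps)
    have "tail V a \<le> q * (exp (- \<alpha> * a) * (q * u y))"
      using q u1 by (intro order_trans[OF V1(1)] mult_left_mono) auto
    moreover have "tail W b \<le> q * (exp (- \<alpha> * b) * (q * v (x - y)))"
      using q v1 by (intro order_trans[OF W1(1)] mult_left_mono) auto
    ultimately have "tail V a * tail W b \<le> q * (exp (- \<alpha> * a) * (q * u y)) * (q * (exp (- \<alpha> * b) * (q * v (x - y))))"
      using nn' q nn by (intro mult_mono) auto
    also have "\<dots> = q ^ 4 * (exp (- \<alpha> * x) * (v (x - y) * u y))"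
      unfolding ee by (simp add: power4_eq_xxxx mult_ac)
    finally have 1: "tail V a * tail W b \<le> q ^ 4 * (exp (- \<alpha> * x) * (v (x - y) * u y))" .
    have "exp (- \<alpha> * a) * u y \<le> exp (- \<alpha> * a) * (q * u a)" using u1 by (intro mult_left_mono) auto
    also have "\<dots> = q * (exp (- \<alpha> * a) * u a)" by simp
    also have "\<dots> \<le> q * (q * tail V a)" using V1 q by (intro mult_left_mono) auto
    finally have 2: "exp (- \<alpha> * a) * u y \<le> q * (q * tail V a)" .
    have "exp (- \<alpha> * b) * v (x - y) \<le> exp (- \<alpha> * b) * (q * v b)" using v1 by (intro mult_left_mono) auto
    also have "\<dots> = q * (exp (- \<alpha> * b) * v b)" by simp
    also have "\<dots> \<le> q * (q * tail W b)" using W1 q by (intro mult_left_mono) auto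
    finally have 3: "exp (- \<alpha> * b) * v (x - y) \<le> q * (q * tail W b)" .
    have "exp (- \<alpha> * x) * (v (x - y) * u y) = (exp (- \<alpha> * a) * u y) * (exp (- \<alpha> * b) * v (x - y))"
      unfolding ee by (simp add: mult_ac)
    also have "\<dots> \<le> (q * (q * tail V a)) * (q * (q * tail W b))"
      using nn' q nn by (intro mult_mono 2 3) auto
    also have "\<dots> = q ^ 4 * (tail V a * tail W b)" by (simp add: power4_eq_xxxx mult_ac)
    finally show ?thesis using 1 by (simp add: a_def b_def)
  qed
  show ?thesis
    by (intro exI[of _ K] conjI ballI) (use main in \<open>auto simp: K_def q_def\<close>)
qed

text \<open>The middle range is compared by \<open>middle_comparison\<close>. Bounding one of the tails by 1 at each
  end, the ends amount to integrated tails of \<open>W\<close> and \<open>V\<close>, which are of the order of the tails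
  themselves and therefore negligible.\<close>

lemma tail_product_integral_asymp:
  assumes e: "e > 0"
  shows "\<forall>\<^sub>F x in along T. tail_product_integral S V W x \<le> ennreal ((1 + e) * (exp (- \<alpha> * x) * otimes v u x)) \<and>
    ennreal (exp (- \<alpha> * x) * otimes v u x) \<le> ennreal (1 + e) * tail_product_integral S V W x"
proof -
  \<comment> \<open>The factor \<open>(1 + d)\<^sup>4 \<le> 1 + 15 d\<close> and two ends of relative size \<open>d\<close> have to stay within \<open>1 + e\<close>.\<close>
  define d where "d = min (1 / 100) (e / 100)"
  have d: "d > 0" "d \<le> 1 / 100" "100 * d \<le> e" using e by (auto simp: d_def)
  define q where "q = (1 + d) ^ 4"
  have q: "q > 0" "q \<le> 1 + 15 * d"
  proof -
    have "d\<^sup>2 \<le> d" "d ^ 3 \<le> d" "d ^ 4 \<le> d"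
      using d power_decreasing[of 1 2 d] power_decreasing[of 1 3 d] power_decreasing[of 1 4 d] by auto
    moreover have "(1 + d) ^ 4 = 1 + 4 * d + 6 * d\<^sup>2 + 4 * d ^ 3 + d ^ 4" by algebra
    ultimately show "q \<le> 1 + 15 * d" by (simp add: q_def)
    show "q > 0" using d by (simp add: q_def)
  qed
  note [measurable] = slowly_varyingD(1)[OF u] slowly_varyingD(1)[OF v] tail_measurable[OF V] tail_measurable[OF W]
  note nn = slowly_varyingD(2)[OF u] slowly_varyingD(2)[OF v] tail_nonneg[OF V] tail_nonneg[OF W]
  define w where "w = otimes v u"
  note nw = otimes_eq_nn_integral[OF v u, folded w_def]
  have w0: "w x \<ge> 0" for x using otimes_nonneg[OF v u] by (simp add: w_def)
  obtain K where K: "K \<ge> 0" and mid: "\<And>x y. x \<in> T \<Longrightarrow> y \<in> {K + 1..x - K} \<Longrightarrow>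
    tail V (round_down S y) * tail W (x - round_down S y) \<le> q * (exp (- \<alpha> * x) * (v (x - y) * u y)) \<and>
    exp (- \<alpha> * x) * (v (x - y) * u y) \<le> q * (tail V (round_down S y) * tail W (x - round_down S y))"
    using middle_comparison[OF d(1)] unfolding q_def by blast
  have K1: "K + 1 \<ge> 0" using K by simp
  obtain cV where cV: "cV > 0" "\<forall>\<^sub>F x in at_top. (\<integral>\<^sup>+s\<in>{x - (K + 1)..}. ennreal (tail V s) \<partial>lborel) \<le> ennreal (cV * (exp (- \<alpha> * x) * u x))"
    using tail_integral_bound[OF V u S tV \<alpha> K1] by blast
  obtain cW where cW: "cW > 0" "\<forall>\<^sub>F x in at_top. (\<integral>\<^sup>+s\<in>{x - (K + 1)..}. ennreal (tail W s) \<partial>lborel) \<le> ennreal (cW * (exp (- \<alpha> * x) * v x))"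
    using tail_integral_bound[OF W v T tW \<alpha> K1] by blast
  obtain cu where cu: "cu \<ge> 0" "\<forall>\<^sub>F x in at_top. (\<integral>\<^sup>+y\<in>{x - (K + 1)..x}. ennreal (v (x - y) * u y) \<partial>lborel) \<le> ennreal (cu * u x)"
    using otimes_edge_le[OF v u] by blast
  obtain cv where cv: "cv \<ge> 0" "\<forall>\<^sub>F x in at_top. (\<integral>\<^sup>+y\<in>{x - (K + 1)..x}. ennreal (u (x - y) * v y) \<partial>lborel) \<le> ennreal (cv * v x)"
    using otimes_edge_le[OF u v] by blast
  \<comment> \<open>Both ends together are to be at most \<open>d\<close> times the convolution.\<close>
  define Bu where "Bu = (cV + cu) / d"
  define Bv where "Bv = (cW + cv) / d"
  have "\<forall>\<^sub>F x in at_top. Bu * u x \<le> w x" unfolding w_def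
    by (rule otimes_dominates[OF v u inf(2)]) (use cV cu d in \<open>auto simp: Bu_def\<close>)
  moreover have "\<forall>\<^sub>F x in at_top. Bv * v x \<le> w x" unfolding w_def otimes_commute[of v u]
    by (rule otimes_dominates[OF u v inf(1)]) (use cW cv d in \<open>auto simp: Bv_def\<close>)
  ultimately have ev: "\<forall>\<^sub>F x in at_top. x \<ge> 2 * K + 1 \<and> (cV + cu) * u x \<le> d * w x \<and> (cW + cv) * v x \<le> d * w x \<and>
     (\<integral>\<^sup>+s\<in>{x - (K + 1)..}. ennreal (tail V s) \<partial>lborel) \<le> ennreal (cV * (exp (- \<alpha> * x) * u x)) \<and>
     (\<integral>\<^sup>+s\<in>{x - (K + 1)..}. ennreal (tail W s) \<partial>lborel) \<le> ennreal (cW * (exp (- \<alpha> * x) * v x)) \<and>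
     (\<integral>\<^sup>+y\<in>{x - (K + 1)..x}. ennreal (v (x - y) * u y) \<partial>lborel) \<le> ennreal (cu * u x) \<and>
     (\<integral>\<^sup>+y\<in>{x - (K + 1)..x}. ennreal (u (x - y) * v y) \<partial>lborel) \<le> ennreal (cv * v x)"
    using cV(2) cW(2) cu(2) cv(2) eventually_ge_at_top[of "2 * K + 1"]
    by eventually_elim (use d in \<open>simp add: Bu_def Bv_def field_simps\<close>)
  show ?thesis unfolding eventually_along using ev
  proof (eventually_elim, intro impI)
    case (elim x)
    assume xT: "x \<in> T"
    define E where "E = exp (- \<alpha> * x)"
    have E: "E > 0" by (simp add: E_def)
    note ELIM = elim[folded E_def]
    have x0: "x \<ge> 0" "u x \<ge> 0" "v x \<ge> 0" using K elim nn by auto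
    have "cu * u x \<le> d * w x" "cV * u x \<le> d * w x" "cv * v x \<le> d * w x" "cW * v x \<le> d * w x"
      using ELIM mult_nonneg_nonneg[OF cu(1) x0(2)] mult_nonneg_nonneg[OF less_imp_le[OF cV(1)] x0(2)]
        mult_nonneg_nonneg[OF cv(1) x0(3)] mult_nonneg_nonneg[OF less_imp_le[OF cW(1)] x0(3)]
      by (auto simp: distrib_right)
    then have small: "cu * (E * u x) \<le> d * (E * w x)" "cV * (E * u x) \<le> d * (E * w x)"
      "cv * (E * v x) \<le> d * (E * w x)" "cW * (E * v x) \<le> d * (E * w x)"
      using E by (simp_all add: mult.left_commute[of _ E])
    define p where "p = (\<lambda>y. tail V (round_down S y) * tail W (x - round_down S y))"
    have [measurable]: "p \<in> borel_measurable borel" unfolding p_def by measurable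
    have p0: "p y \<ge> 0" for y using nn by (simp add: p_def)
    have P: "tail_product_integral S V W x = (\<integral>\<^sup>+y. ennreal (p y) \<partial>lborel)"
      by (simp add: tail_product_integral_def p_def)
    have edgeW: "(\<integral>\<^sup>+y. ennreal (tail W (x - y)) * indicator {..K + 1} y \<partial>lborel) \<le> ennreal (d * (E * w x))"
    proof -
      have "(\<integral>\<^sup>+s\<in>{x - (K + 1)..}. ennreal (tail W s) \<partial>lborel) = (\<integral>\<^sup>+y. ennreal (tail W (x - y)) * indicator {..K + 1} y \<partial>lborel)"
        by (subst nn_integral_real_affine[where c = "-1" and t = x]) (auto simp: indicator_def intro!: nn_integral_cong)
      then show ?thesis using ELIM small by (auto intro: order_trans ennreal_leI)
    qed
    have edgeV: "(\<integral>\<^sup>+y. ennreal (tail V (y - 1)) * indicator {x - K..} y \<partial>lborel) \<le> ennreal (d * (E * w x))"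
    proof -
      have "(\<integral>\<^sup>+s\<in>{x - (K + 1)..}. ennreal (tail V s) \<partial>lborel) = (\<integral>\<^sup>+y. ennreal (tail V (y - 1)) * indicator {x - K..} y \<partial>lborel)"
        by (subst nn_integral_real_affine[where c = "1" and t = "-1"]) (auto simp: indicator_def intro!: nn_integral_cong)
      then show ?thesis using ELIM small by (auto intro: order_trans ennreal_leI)
    qed
    have edgeu: "ennreal E * (\<integral>\<^sup>+y. ennreal (v (x - y) * u y) * indicator {x - (K + 1)..x} y \<partial>lborel) \<le> ennreal (d * (E * w x))"
    proof -
      have "ennreal E * (\<integral>\<^sup>+y. ennreal (v (x - y) * u y) * indicator {x - (K + 1)..x} y \<partial>lborel) \<le> ennreal E * ennreal (cu * u x)"
        using ELIM by (intro mult_left_mono) auto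
      also have "\<dots> = ennreal (cu * (E * u x))" using E cu x0 by (simp add: ennreal_mult'[symmetric] mult_ac)
      finally show ?thesis using small by (auto intro: order_trans ennreal_leI)
    qed
    have edgev: "ennreal E * (\<integral>\<^sup>+y. ennreal (v (x - y) * u y) * indicator {0..K + 1} y \<partial>lborel) \<le> ennreal (d * (E * w x))"
    proof -
      have "(\<integral>\<^sup>+y\<in>{x - (K + 1)..x}. ennreal (u (x - y) * v y) \<partial>lborel) = (\<integral>\<^sup>+y. ennreal (v (x - y) * u y) * indicator {0..K + 1} y \<partial>lborel)"
        by (subst nn_integral_real_affine[where c = "-1" and t = x]) (auto simp: indicator_def mult.commute intro!: nn_integral_cong)
      then have "ennreal E * (\<integral>\<^sup>+y. ennreal (v (x - y) * u y) * indicator {0..K + 1} y \<partial>lborel) \<le> ennreal E * ennreal (cv * v x)"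
        using ELIM by (intro mult_left_mono) auto
      also have "\<dots> = ennreal (cv * (E * v x))" using E cv x0 by (simp add: ennreal_mult'[symmetric] mult_ac)
      finally show ?thesis using small by (auto intro: order_trans ennreal_leI)
    qed
    have "tail_product_integral S V W x \<le> (\<integral>\<^sup>+y. (ennreal (q * E) * (ennreal (v (x - y) * u y) * indicator {0..x} y) +
        ennreal (tail W (x - y)) * indicator {..K + 1} y) + ennreal (tail V (y - 1)) * indicator {x - K..} y \<partial>lborel)"
      unfolding P
    proof (intro nn_integral_mono)
      fix y
      note rd = round_down[OF S, of y]
      consider "y < K + 1" | "y > x - K" | "y \<in> {K + 1..x - K}" by fastforce
      then show "ennreal (p y) \<le> (ennreal (q * E) * (ennreal (v (x - y) * u y) * indicator {0..x} y) +
        ennreal (tail W (x - y)) * indicator {..K + 1} y) + ennreal (tail V (y - 1)) * indicator {x - K..} y"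
      proof cases
        case 1
        have "p y \<le> 1 * tail W (x - y)"
          unfolding p_def using rd nn by (intro mult_mono tail_le_1[OF V] tail_antimono[OF W]) auto
        then have "ennreal (p y) \<le> ennreal (tail W (x - y))" by (intro ennreal_leI) simp
        then show ?thesis using 1 by (simp add: add_increasing add_increasing2)
      next
        case 2
        have "p y \<le> tail V (y - 1) * 1"
          unfolding p_def using rd nn by (intro mult_mono tail_le_1[OF W] tail_antimono[OF V]) auto
        then have "ennreal (p y) \<le> ennreal (tail V (y - 1))" by (intro ennreal_leI) simp
        then show ?thesis using 2 by (simp add: add_increasing add_increasing2)
      next
        case 3
        then have "p y \<le> q * (E * (v (x - y) * u y))" using mid[OF xT 3] by (simp add: p_def E_def)
        then have "ennreal (p y) \<le> ennreal (q * E) * ennreal (v (x - y) * u y)"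
          using q E nn 3 K by (subst ennreal_mult[symmetric]) (auto intro!: ennreal_leI simp: mult_ac)
        then show ?thesis using 3 K by (auto intro!: add_increasing2)
      qed
    qed
    also have "\<dots> = ennreal (q * E) * ennreal (w x) + (\<integral>\<^sup>+y. ennreal (tail W (x - y)) * indicator {..K + 1} y \<partial>lborel) +
       (\<integral>\<^sup>+y. ennreal (tail V (y - 1)) * indicator {x - K..} y \<partial>lborel)"
      by (simp add: nn_integral_add nn_integral_cmult nw)
    also have "\<dots> \<le> ennreal (q * E) * ennreal (w x) + ennreal (d * (E * w x)) + ennreal (d * (E * w x))"
      by (intro add_mono edgeV edgeW order_refl)
    also have "\<dots> = ennreal ((q + 2 * d) * (E * w x))"
      using q E w0[of x] d by (simp add: ennreal_mult[symmetric] ennreal_plus[symmetric] algebra_simps del: ennreal_plus)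
    also have "\<dots> \<le> ennreal ((1 + e) * (E * w x))"
      using q d E w0[of x] by (intro ennreal_leI mult_right_mono) auto
    finally have upper: "tail_product_integral S V W x \<le> ennreal ((1 + e) * (E * w x))" .
    then have fin: "tail_product_integral S V W x \<noteq> top" by (auto simp: top_unique)
    define j where "j = enn2real (tail_product_integral S V W x)"
    have j: "tail_product_integral S V W x = ennreal j" "j \<ge> 0" using fin by (simp_all add: j_def less_top)
    have "ennreal (E * w x) = ennreal E * (\<integral>\<^sup>+y\<in>{0..x}. ennreal (v (x - y) * u y) \<partial>lborel)"
      using E by (simp add: ennreal_mult' nw)
    also have "\<dots> = (\<integral>\<^sup>+y. ennreal E * (ennreal (v (x - y) * u y) * indicator {0..x} y) \<partial>lborel)"
      by (subst nn_integral_cmult) auto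
    also have "\<dots> \<le> (\<integral>\<^sup>+y. (ennreal q * ennreal (p y) + ennreal E * (ennreal (v (x - y) * u y) * indicator {0..K + 1} y)) +
        ennreal E * (ennreal (v (x - y) * u y) * indicator {x - (K + 1)..x} y) \<partial>lborel)"
    proof (intro nn_integral_mono)
      fix y
      consider "y \<notin> {0..x}" | "y \<in> {0..K + 1}" | "y \<in> {x - (K + 1)..x}" | "y \<in> {K + 1..x - K}" by fastforce
      then show "ennreal E * (ennreal (v (x - y) * u y) * indicator {0..x} y) \<le>
        (ennreal q * ennreal (p y) + ennreal E * (ennreal (v (x - y) * u y) * indicator {0..K + 1} y)) +
        ennreal E * (ennreal (v (x - y) * u y) * indicator {x - (K + 1)..x} y)"
      proof cases
        case 4
        then have "E * (v (x - y) * u y) \<le> q * p y" using mid[OF xT 4] by (simp add: p_def E_def)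
        then have "ennreal E * ennreal (v (x - y) * u y) \<le> ennreal q * ennreal (p y)"
          using q E p0[of y] by (simp add: ennreal_mult'[symmetric] ennreal_leI)
        then show ?thesis using 4 K by (auto intro!: add_increasing2)
      qed (auto simp: indicator_def intro: add_increasing add_increasing2)
    qed
    also have "\<dots> = ennreal q * tail_product_integral S V W x + ennreal E * (\<integral>\<^sup>+y. ennreal (v (x - y) * u y) * indicator {0..K + 1} y \<partial>lborel)
       + ennreal E * (\<integral>\<^sup>+y. ennreal (v (x - y) * u y) * indicator {x - (K + 1)..x} y \<partial>lborel)"
      by (simp add: nn_integral_add nn_integral_cmult P)
    also have "\<dots> \<le> ennreal q * tail_product_integral S V W x + ennreal (d * (E * w x)) + ennreal (d * (E * w x))"
      by (intro add_mono edgeu edgev order_refl)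
    also have "\<dots> = ennreal (q * j + 2 * d * (E * w x))"
      using q E w0[of x] d j by (simp add: ennreal_mult[symmetric] ennreal_plus[symmetric] algebra_simps del: ennreal_plus)
    finally have "E * w x \<le> q * j + 2 * d * (E * w x)"
      using q E w0[of x] d j by (simp del: ennreal_plus)
    then have "(1 - 2 * d) * (E * w x) \<le> (1 + 15 * d) * j"
      using mult_right_mono[OF q(2) j(2)] by (simp add: algebra_simps)
    moreover have "1 + 15 * d \<le> (1 - 2 * d) * (1 + e)"
    proof -
      have "d * (e * 2) \<le> 1 / 100 * (e * 2)" using d e by (intro mult_right_mono) auto
      moreover have "(1 - 2 * d) * (1 + e) = 1 + e - 2 * d - d * (e * 2)" by (simp add: algebra_simps)
      ultimately show ?thesis using d by linarith
    qed
    ultimately have "(1 - 2 * d) * (E * w x) \<le> (1 - 2 * d) * ((1 + e) * j)"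
      using mult_right_mono[of "1 + 15 * d" "(1 - 2 * d) * (1 + e)" j] j by (simp add: mult.assoc)
    then have "E * w x \<le> (1 + e) * j" using d by (simp add: mult_le_cancel_left)
    then have "ennreal (E * w x) \<le> ennreal (1 + e) * tail_product_integral S V W x"
      using e j by (simp add: ennreal_mult'[symmetric] ennreal_leI del: ennreal_plus)
    with upper show "tail_product_integral S V W x \<le> ennreal ((1 + e) * (exp (- \<alpha> * x) * otimes v u x)) \<and>
      ennreal (exp (- \<alpha> * x) * otimes v u x) \<le> ennreal (1 + e) * tail_product_integral S V W x"
      by (simp add: E_def w_def)
  qed
qed

end

section \<open>The tail of a convolution of two distributions\<close>

text \<open>The length of an interval of length \<open>w\<close>, or the number of integers strictly between \<open>- w\<close>
  and 0.\<close>

definition overshoot :: "real set \<Rightarrow> real \<Rightarrow> real" where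
  "overshoot S w = (if S = UNIV then max 0 w else max 0 (of_int \<lceil>w\<rceil> - 1))"

lemma overshoot_measurable [measurable]: "overshoot S \<in> borel_measurable borel"
proof -
  have "mono (overshoot S)"
    by (auto simp: mono_def overshoot_def max_def ceiling_mono intro: order_trans ceiling_mono)
  then show ?thesis by (rule borel_measurable_mono)
qed

lemma emeasure_rounded_window:
  assumes S: "S \<in> {UNIV, \<int>}" and a: "a \<in> S"
  shows "emeasure lborel {y. round_down S y < a \<and> x - round_down S y < b} = ennreal (overshoot S (a + b - x))"
proof (cases "S = UNIV")
  case True
  have "{y. round_down S y < a \<and> x - round_down S y < b} = {x - b<..<a}"
    using True by (auto simp: round_down_def)
  moreover have "emeasure lborel {x - b<..<a} = ennreal (max 0 (a + b - x))"
    by (cases "x - b \<le> a") (auto simp: max_def algebra_simps ennreal_neg)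
  ultimately show ?thesis using True by (simp add: overshoot_def)
next
  case False
  then obtain k where k: "a = of_int k" using S a by (auto elim: Ints_cases)
  have "{y. round_down S y < a \<and> x - round_down S y < b} = {of_int (\<lfloor>x - b\<rfloor> + 1)..<of_int k}"
  proof -
    have "x - of_int \<lfloor>y\<rfloor> < b \<longleftrightarrow> of_int (\<lfloor>x - b\<rfloor> + 1) \<le> y" for y :: real
    proof -
      have "x - of_int \<lfloor>y\<rfloor> < b \<longleftrightarrow> x - b < of_int \<lfloor>y\<rfloor>" by argo
      also have "\<dots> \<longleftrightarrow> \<lfloor>x - b\<rfloor> < \<lfloor>y\<rfloor>" by (rule floor_less_iff[symmetric])
      also have "\<dots> \<longleftrightarrow> \<lfloor>x - b\<rfloor> + 1 \<le> \<lfloor>y\<rfloor>" by (rule add1_zle_eq[symmetric])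
      also have "\<dots> \<longleftrightarrow> of_int (\<lfloor>x - b\<rfloor> + 1) \<le> y" by (rule le_floor_iff)
      finally show ?thesis .
    qed
    moreover have "of_int \<lfloor>y\<rfloor> < (of_int k :: real) \<longleftrightarrow> y < of_int k" for y :: real
      using floor_less_iff[of y k] by (simp only: of_int_less_iff)
    ultimately show ?thesis using False k by (simp only: round_down_def if_False) auto
  qed
  moreover have "overshoot S (a + b - x) = max 0 (of_int k - of_int (\<lfloor>x - b\<rfloor> + 1))"
  proof -
    have "\<lceil>a + b - x\<rceil> = k - \<lfloor>x - b\<rfloor>"
    proof -
      have "\<lceil>a + b - x\<rceil> = \<lceil>of_int k - (x - b)\<rceil>" by (simp add: k algebra_simps)
      then show ?thesis by (simp add: ceiling_def)
    qed
    then show ?thesis using False by (simp add: overshoot_def)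
  qed
  moreover have "emeasure lborel {of_int (\<lfloor>x - b\<rfloor> + 1)..<of_int k :: real} = ennreal (max 0 (of_int k - of_int (\<lfloor>x - b\<rfloor> + 1)))"
    by (cases "of_int (\<lfloor>x - b\<rfloor> + 1) \<le> (of_int k :: real)") (auto simp: max_def ennreal_neg)
  ultimately show ?thesis by simp
qed

lemma real_distribution_convolution:
  assumes "real_distribution V" "real_distribution W"
  shows "real_distribution (V \<star> W)"
proof -
  interpret V: real_distribution V by fact
  interpret W: real_distribution W by fact
  interpret P: pair_prob_space V W ..
  have "prob_space (V \<star> W)" unfolding convolution_def
    by (rule P.prob_space_distr) simp
  then show ?thesis by (simp add: real_distribution_def real_distribution_axioms_def)
qed

text \<open>Write each tail as the integral of an indicator function and integrate over \<open>y\<close> first.\<close>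

lemma tail_product_integral_eq_overshoot:
  assumes V: "real_distribution V" and W: "real_distribution W" and S: "S \<in> {UNIV, \<int>}" and VS: "AE a in V. a \<in> S"
  shows "tail_product_integral S V W x = (\<integral>\<^sup>+z. ennreal (overshoot S (z - x)) \<partial>(V \<star> W))"
proof -
  interpret V: real_distribution V by fact
  interpret W: real_distribution W by fact
  have [measurable_cong]: "sets V = sets borel" "sets W = sets borel" by simp_all
  interpret VL: pair_sigma_finite V lborel ..
  interpret WL: pair_sigma_finite W lborel ..
  note [measurable] = tail_measurable[OF W]
  have "tail_product_integral S V W x = (\<integral>\<^sup>+y. (\<integral>\<^sup>+a. (if round_down S y < a then ennreal (tail W (x - round_down S y)) else 0) \<partial>V) \<partial>lborel)"
    unfolding tail_product_integral_def
  proof (intro nn_integral_cong)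
    fix y
    have "(\<integral>\<^sup>+a. (if round_down S y < a then ennreal (tail W (x - round_down S y)) else 0) \<partial>V) =
      (\<integral>\<^sup>+a. ennreal (tail W (x - round_down S y)) * indicator {round_down S y<..} a \<partial>V)"
      by (intro nn_integral_cong) (auto simp: indicator_def)
    also have "\<dots> = ennreal (tail W (x - round_down S y)) * ennreal (tail V (round_down S y))"
      by (simp add: nn_integral_cmult_indicator emeasure_greaterThan_tail[OF V])
    finally show "ennreal (tail V (round_down S y) * tail W (x - round_down S y)) =
      (\<integral>\<^sup>+a. (if round_down S y < a then ennreal (tail W (x - round_down S y)) else 0) \<partial>V)"
      by (simp add: ennreal_mult tail_nonneg V W mult.commute)
  qed
  also have "\<dots> = (\<integral>\<^sup>+a. (\<integral>\<^sup>+y. (if round_down S y < a then ennreal (tail W (x - round_down S y)) else 0) \<partial>lborel) \<partial>V)"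
    by (rule VL.Fubini') measurable
  also have "\<dots> = (\<integral>\<^sup>+a. (\<integral>\<^sup>+b. ennreal (overshoot S (a + b - x)) \<partial>W) \<partial>V)"
  proof (rule nn_integral_cong_AE, use VS in eventually_elim)
    case (elim a)
    have "(\<integral>\<^sup>+y. (if round_down S y < a then ennreal (tail W (x - round_down S y)) else 0) \<partial>lborel) =
      (\<integral>\<^sup>+y. (\<integral>\<^sup>+b. (if round_down S y < a \<and> x - round_down S y < b then 1 else 0) \<partial>W) \<partial>lborel)"
    proof (intro nn_integral_cong)
      fix y
      have "(\<integral>\<^sup>+b. (if round_down S y < a \<and> x - round_down S y < b then 1 else 0) \<partial>W) =
        (\<integral>\<^sup>+b. (if round_down S y < a then 1 else 0) * indicator {x - round_down S y<..} b \<partial>W)"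
        by (intro nn_integral_cong) (auto simp: indicator_def)
      also have "\<dots> = (if round_down S y < a then 1 else 0) * ennreal (tail W (x - round_down S y))"
        by (subst nn_integral_cmult_indicator) (simp_all add: emeasure_greaterThan_tail[OF W])
      finally show "(if round_down S y < a then ennreal (tail W (x - round_down S y)) else 0) =
        (\<integral>\<^sup>+b. (if round_down S y < a \<and> x - round_down S y < b then 1 else 0) \<partial>W)" by simp
    qed
    also have "\<dots> = (\<integral>\<^sup>+b. (\<integral>\<^sup>+y. (if round_down S y < a \<and> x - round_down S y < b then 1 else 0) \<partial>lborel) \<partial>W)"
      by (rule WL.Fubini') measurable
    also have "\<dots> = (\<integral>\<^sup>+b. ennreal (overshoot S (a + b - x)) \<partial>W)"
    proof (intro nn_integral_cong)
      fix b
      have "(\<integral>\<^sup>+y. (if round_down S y < a \<and> x - round_down S y < b then 1 else 0) \<partial>lborel) =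
        (\<integral>\<^sup>+y. indicator {y. round_down S y < a \<and> x - round_down S y < b} y \<partial>lborel)"
        by (intro nn_integral_cong) (auto simp: indicator_def)
      also have "\<dots> = emeasure lborel {y. round_down S y < a \<and> x - round_down S y < b}"
        by (rule nn_integral_indicator) simp
      finally show "(\<integral>\<^sup>+y. (if round_down S y < a \<and> x - round_down S y < b then 1 else 0) \<partial>lborel) = ennreal (overshoot S (a + b - x))"
        by (simp add: emeasure_rounded_window[OF S elim])
    qed
    finally show ?case .
  qed
  also have "\<dots> = (\<integral>\<^sup>+z. ennreal (overshoot S (z - x)) \<partial>(V \<star> W))"
    by (subst nn_integral_convolution) (auto simp: V.finite_measure_axioms W.finite_measure_axioms)
  finally show ?thesis .
qed

text \<open>Integrate the elementary inequalities between \<open>(w - h)\<^sup>+\<close> and \<open>w\<^sup>+\<close>; in the integer case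
  with \<open>h = 1\<close> they become an equality.\<close>

lemma overshoot_increments:
  assumes V: "real_distribution V"
  defines "J \<equiv> \<lambda>S x. \<integral>\<^sup>+z. ennreal (overshoot S (z - x)) \<partial>V"
  shows "h > 0 \<Longrightarrow> J UNIV x \<le> J UNIV (x + h) + ennreal (h * tail V x)"
    and "h > 0 \<Longrightarrow> J UNIV (x + h) + ennreal (h * tail V (x + h)) \<le> J UNIV x"
    and "J \<int> x = J \<int> (x + 1) + ennreal (tail V (x + 1))"
proof -
  interpret V: real_distribution V by fact
  have [measurable_cong]: "sets V = sets borel" by simp
  have split: "J S y + ennreal (h * tail V x) = (\<integral>\<^sup>+z. ennreal (overshoot S (z - y) + h * indicator {x<..} z) \<partial>V)"
    if "h > 0" for S h x y
  proof -
    have "ennreal (h * tail V x) = (\<integral>\<^sup>+z. ennreal h * indicator {x<..} z \<partial>V)"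
      using that by (simp add: nn_integral_cmult_indicator emeasure_greaterThan_tail[OF V] ennreal_mult')
    then have "J S y + ennreal (h * tail V x) = (\<integral>\<^sup>+z. ennreal (overshoot S (z - y)) + ennreal h * indicator {x<..} z \<partial>V)"
      by (simp add: J_def nn_integral_add)
    also have "\<dots> = (\<integral>\<^sup>+z. ennreal (overshoot S (z - y) + h * indicator {x<..} z) \<partial>V)"
      using that by (intro nn_integral_cong) (auto simp: indicator_def overshoot_def)
    finally show ?thesis .
  qed
  show "h > 0 \<Longrightarrow> J UNIV x \<le> J UNIV (x + h) + ennreal (h * tail V x)"
    unfolding split unfolding J_def
    by (intro nn_integral_mono ennreal_leI) (auto simp: overshoot_def indicator_def)
  show "h > 0 \<Longrightarrow> J UNIV (x + h) + ennreal (h * tail V (x + h)) \<le> J UNIV x"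
    unfolding split unfolding J_def
    by (intro nn_integral_mono ennreal_leI) (auto simp: overshoot_def indicator_def)
  have "overshoot \<int> (z - x) = overshoot \<int> (z - (x + 1)) + 1 * indicator {x + 1<..} z" for z
  proof -
    have c: "\<lceil>z - (x + 1)\<rceil> = \<lceil>z - x\<rceil> - 1" using ceiling_diff_of_int[of "z - x" 1] by (simp add: algebra_simps)
    show ?thesis
    proof (cases "z > x + 1")
      case True
      then have "\<lceil>z - (x + 1)\<rceil> \<ge> 1" by (simp add: le_ceiling_iff)
      then show ?thesis using True c by (simp add: overshoot_def)
    next
      case False
      then have "\<lceil>z - (x + 1)\<rceil> \<le> 0" by (simp add: ceiling_le_iff)
      then show ?thesis using False c by (simp add: overshoot_def)
    qed
  qed
  then show "J \<int> x = J \<int> (x + 1) + ennreal (tail V (x + 1))"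
    using split[of 1 \<int> "x + 1" "x + 1"] by (simp add: J_def)
qed

lemma tendsto_1_of_ratio_bounds:
  fixes f g :: "real \<Rightarrow> real"
  assumes "\<And>e. e > 0 \<Longrightarrow> \<forall>\<^sub>F x in F. f x \<le> (1 + e) * g x \<and> g x \<le> (1 + e) * f x"
    and pos: "\<forall>\<^sub>F x in F. g x > 0"
  shows "((\<lambda>x. f x / g x) \<longlongrightarrow> 1) F"
proof (rule tendstoI)
  fix e :: real assume e: "e > 0"
  then have e2: "e / 2 > 0" by simp
  show "\<forall>\<^sub>F x in F. dist (f x / g x) 1 < e"
    using assms(1)[OF e2] pos
  proof eventually_elim
    case (elim x)
    have r: "f x / g x \<le> 1 + e / 2" "1 \<le> (1 + e / 2) * (f x / g x)"
      using elim e by (auto simp: field_simps)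
    have "f x / g x > 1 - e"
    proof (rule ccontr)
      assume "\<not> ?thesis"
      then have "(1 + e / 2) * (f x / g x) \<le> (1 + e / 2) * (1 - e)" using e by (intro mult_left_mono) auto
      also have "\<dots> < 1" using e by (simp add: algebra_simps add_pos_pos)
      finally show False using r by simp
    qed
    then show ?case using r e by (auto simp: dist_real_def abs_less_iff)
  qed
qed

lemma slowly_varying_shift_tendsto:
  assumes u: "slowly_varying u"
  shows "((\<lambda>x. u (x + t) / u x) \<longlongrightarrow> 1) at_top"
proof -
  have nonneg: "((\<lambda>x. u (x + t) / u x) \<longlongrightarrow> 1) at_top" if t: "t \<ge> 0" for t
  proof (rule tendsto_1_of_ratio_bounds)
    fix e :: real assume "e > 0"
    from slowly_varying_uniform[OF u this, of t]
    show "\<forall>\<^sub>F x in at_top. u (x + t) \<le> (1 + e) * u x \<and> u x \<le> (1 + e) * u (x + t)"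
      by eventually_elim (use t in auto)
  qed (rule slowly_varyingD(4)[OF u])
  show ?thesis
  proof (cases "t \<ge> 0")
    case False
    have "((\<lambda>x. u (x + - t) / u x) \<longlongrightarrow> 1) at_top" using nonneg[of "- t"] False by simp
    moreover have "filterlim (\<lambda>x. x + t) at_top at_top" 
      using filterlim_tendsto_add_at_top[OF tendsto_const filterlim_ident, of t] by (simp add: add.commute)
    ultimately have "((\<lambda>x. u (x + t + - t) / u (x + t)) \<longlongrightarrow> 1) at_top"
      by (rule filterlim_compose)
    then have "((\<lambda>x. inverse (u x / u (x + t))) \<longlongrightarrow> inverse 1) at_top" by (intro tendsto_inverse) auto
    then show ?thesis by (simp add: inverse_divide)
  qed (rule nonneg)
qed

lemma filterlim_along_shift:
  assumes "\<And>x. x \<in> T \<Longrightarrow> x + t \<in> T"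
  shows "filterlim (\<lambda>x. x + t :: real) (along T) (along T)"
proof -
  have "filterlim (\<lambda>x. x + t) at_top at_top" 
      using filterlim_tendsto_add_at_top[OF tendsto_const filterlim_ident, of t] by (simp add: add.commute)
  then have "filterlim (\<lambda>x. x + t) at_top (along T)" by (rule filterlim_mono) (auto simp: along_le_at_top)
  moreover have "filterlim (\<lambda>x. x + t) (principal T) (along T)"
    unfolding filterlim_principal using eventually_in_along[of T] by eventually_elim (rule assms)
  ultimately show ?thesis by (simp add: along_def filterlim_inf)
qed

text \<open>A monotone density argument: \<open>J\<close> is equivalent to \<open>g\<close>, whose ratio under a shift by \<open>t\<close>
  tends to \<open>exp (- \<alpha> t)\<close>, and the tail of the convolution is recovered from increments of \<open>J\<close>.
  Only the lattice distribution, if there is exactly one, may play the role of \<open>V\<close>, because the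
  identity sums over the lattice of \<open>V\<close>.\<close>

theorem convolution_tail_tendsto:
  fixes \<alpha> :: real and V W :: "real measure" and u v :: "real \<Rightarrow> real" and S T :: "real set"
  assumes \<alpha>: "\<alpha> > 0"
    and V: "real_distribution V" and W: "real_distribution W"
    and u: "slowly_varying u" and v: "slowly_varying v"
    and inf: "infinite_integral u" "infinite_integral v"
    and S: "S \<in> {UNIV, \<int>}" and T: "T \<in> {UNIV, \<int>}" and ST: "S \<subseteq> T"
    and tV: "tail V \<sim>[along S] (\<lambda>x. exp (- \<alpha> * x) * u x)"
    and tW: "tail W \<sim>[along T] (\<lambda>x. exp (- \<alpha> * x) * v x)"
    and VS: "AE a in V. a \<in> S"
  shows "((\<lambda>x. tail (V \<star> W) x / (exp (- \<alpha> * x) * otimes v u x)) \<longlongrightarrow> (if S = UNIV then \<alpha> else exp \<alpha> - 1)) (along T)"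
proof -
  define w where "w = otimes v u"
  define g where "g = (\<lambda>x. exp (- \<alpha> * x) * w x)"
  define J where "J = (\<lambda>x. enn2real (tail_product_integral S V W x))"
  define C where "C = tail (V \<star> W)"
  have w: "slowly_varying w" unfolding w_def by (rule slowly_varying_otimes[OF v u inf(2)])
  have C: "real_distribution (V \<star> W)" by (rule real_distribution_convolution[OF V W])
  have gpos: "\<forall>\<^sub>F x in along T. g x > 0"
    using filter_leD[OF along_le_at_top slowly_varyingD(4)[OF w]] by eventually_elim (simp add: g_def)
  note cmp = tail_product_integral_asymp[OF \<alpha> V W u v inf S T ST tV tW, folded w_def g_def]
  have cmp: "\<forall>\<^sub>F x in along T. tail_product_integral S V W x \<le> ennreal ((1 + e) * g x) \<and>
    ennreal (g x) \<le> ennreal (1 + e) * tail_product_integral S V W x" if "e > 0" for e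
    using cmp[OF that] by (simp add: g_def)
  have fin: "\<forall>\<^sub>F x in along T. tail_product_integral S V W x = ennreal (J x)"
    using cmp[of 1] by (rule eventually_mono)
      (auto simp: J_def intro!: ennreal_enn2real[symmetric] intro: le_less_trans[OF _ ennreal_less_top])
  have J0: "J x \<ge> 0" for x by (simp add: J_def)
  have Jg: "((\<lambda>x. J x / g x) \<longlongrightarrow> 1) (along T)"
  proof (rule tendsto_1_of_ratio_bounds[OF _ gpos])
    fix e :: real assume e: "e > 0"
    show "\<forall>\<^sub>F x in along T. J x \<le> (1 + e) * g x \<and> g x \<le> (1 + e) * J x"
      using cmp[OF e] fin gpos
    proof eventually_elim
      case (elim x)
      then have "ennreal (J x) \<le> ennreal ((1 + e) * g x)" "ennreal (g x) \<le> ennreal ((1 + e) * J x)"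
        using e J0[of x] by (auto simp: ennreal_mult)
      then show ?case using e J0[of x] elim(3) by (auto simp: ennreal_le_iff)
    qed
  qed
  have shift: "filterlim (\<lambda>x. x + t) (along T) (along T)" if "t \<in> T" for t
    by (rule filterlim_along_shift) (use that T in auto)
  have gshift: "((\<lambda>x. g (x + t) / g x) \<longlongrightarrow> exp (- \<alpha> * t)) (along T)" for t
  proof -
    have "((\<lambda>x. exp (- \<alpha> * t) * (w (x + t) / w x)) \<longlongrightarrow> exp (- \<alpha> * t) * 1) (along T)"
      by (intro tendsto_mult tendsto_const filterlim_mono[OF slowly_varying_shift_tendsto[OF w] order_refl along_le_at_top])
    moreover have "exp (- \<alpha> * t) * (w (x + t) / w x) = g (x + t) / g x" for x
      by (simp add: g_def ring_distribs exp_diff exp_minus field_simps exp_add)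
    ultimately show ?thesis by simp
  qed
  have Jshift: "((\<lambda>x. J (x + t) / g x) \<longlongrightarrow> exp (- \<alpha> * t)) (along T)" if t: "t \<in> T" for t
  proof -
    have "((\<lambda>x. J (x + t) / g (x + t) * (g (x + t) / g x)) \<longlongrightarrow> 1 * exp (- \<alpha> * t)) (along T)"
      by (intro tendsto_mult gshift filterlim_compose[OF Jg shift[OF t]])
    moreover have "\<forall>\<^sub>F x in along T. J (x + t) / g (x + t) * (g (x + t) / g x) = J (x + t) / g x"
      using eventually_compose_filterlim[OF gpos shift[OF t]] by eventually_elim auto
    ultimately have "((\<lambda>x. J (x + t) / g x) \<longlongrightarrow> 1 * exp (- \<alpha> * t)) (along T)"
      by (rule Lim_transform_eventually)
    then show ?thesis by (simp only: mult_1)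
  qed
  note id = tail_product_integral_eq_overshoot[OF V W S VS]
  have finshift: "\<forall>\<^sub>F x in along T. (\<integral>\<^sup>+z. ennreal (overshoot S (z - (x + t))) \<partial>(V \<star> W)) = ennreal (J (x + t))" if "t \<in> T" for t
    using eventually_compose_filterlim[OF fin shift[OF that]] by (simp add: id)
  have "((\<lambda>x. C x / g x) \<longlongrightarrow> (if S = UNIV then \<alpha> else exp \<alpha> - 1)) (along T)"
  proof (cases "S = UNIV")
    case False
    then have S: "S = \<int>" using S by auto
    have 01: "0 \<in> T" "- 1 \<in> T" using T by auto
    have "\<forall>\<^sub>F x in along T. J (x + - 1) / g x - J (x + 0) / g x = C x / g x"
      using finshift[OF 01(1)] finshift[OF 01(2)]
    proof eventually_elim
      case (elim x)
      have "ennreal (J (x - 1)) = ennreal (J x + C x)"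
        using overshoot_increments(3)[OF C, of "x - 1"] elim J0[of x] tail_nonneg[OF C, of x] by (simp add: S C_def)
      then have "J (x - 1) = J x + C x"
        using J0[of x] J0[of "x - 1"] tail_nonneg[OF C, of x] by (subst (asm) ennreal_inj) (auto simp: C_def)
      then show ?case by (simp add: diff_divide_distrib[symmetric])
    qed
    moreover have "((\<lambda>x. J (x + - 1) / g x - J (x + 0) / g x) \<longlongrightarrow> exp (- \<alpha> * (- 1)) - exp (- \<alpha> * 0)) (along T)"
      by (intro tendsto_diff Jshift 01)
    ultimately show ?thesis using False by (simp add: tendsto_cong)
  next
    case True
    then have T: "T = UNIV" using ST by auto
    have le: "\<forall>\<^sub>F x in along T. (J (x + 0) / g x - J (x + h) / g x) / h \<le> C x / g x \<and>
        C x / g x \<le> (J (x + - h) / g x - J (x + 0) / g x) / h" if h: "h > 0" for h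
    proof -
      have "\<forall>\<^sub>F x in along T. (\<integral>\<^sup>+z. ennreal (overshoot S (z - (x + 0))) \<partial>(V \<star> W)) = ennreal (J (x + 0))"
        "\<forall>\<^sub>F x in along T. (\<integral>\<^sup>+z. ennreal (overshoot S (z - (x + h))) \<partial>(V \<star> W)) = ennreal (J (x + h))"
        "\<forall>\<^sub>F x in along T. (\<integral>\<^sup>+z. ennreal (overshoot S (z - (x + - h))) \<partial>(V \<star> W)) = ennreal (J (x + - h))"
        by (rule finshift; simp add: T)+
      then show ?thesis using gpos
      proof eventually_elim
        case (elim x)
        have C0: "C x \<ge> 0" using tail_nonneg[OF C, of x] by (simp add: C_def)
        have "ennreal (J x) \<le> ennreal (J (x + h)) + ennreal (h * C x)"
          using overshoot_increments(1)[OF C h, of x] elim True by (simp add: C_def)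
        also have "\<dots> = ennreal (J (x + h) + h * C x)" using J0 C0 h by simp
        finally have 1: "J x \<le> J (x + h) + h * C x" using J0 C0 h by (subst (asm) ennreal_le_iff) auto
        have "ennreal (J x) + ennreal (h * C x) \<le> ennreal (J (x - h))"
          using overshoot_increments(2)[OF C h, of "x - h"] elim True by (simp add: C_def)
        also have "ennreal (J x) + ennreal (h * C x) = ennreal (J x + h * C x)" using J0 C0 h by simp
        finally have 2: "J x + h * C x \<le> J (x - h)" using J0 C0 h by (subst (asm) ennreal_le_iff) auto
        have "(J x - J (x + h)) / h \<le> C x" "C x \<le> (J (x - h) - J x) / h"
          using 1 2 h by (simp_all add: field_simps)
        then have "(J x - J (x + h)) / h / g x \<le> C x / g x" "C x / g x \<le> (J (x - h) - J x) / h / g x"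
          using divide_right_mono[OF _ less_imp_le[OF elim(4)]] by blast+
        moreover have "(a / g x - b / g x) / h = (a - b) / h / g x" for a b
          by (simp add: diff_divide_distrib mult.commute)
        ultimately show ?case by simp
      qed
    qed
    have lo: "((\<lambda>x. (J (x + 0) / g x - J (x + h) / g x) / h) \<longlongrightarrow> (exp (- \<alpha> * 0) - exp (- \<alpha> * h)) / h) (along T)"
      and up: "((\<lambda>x. (J (x + - h) / g x - J (x + 0) / g x) / h) \<longlongrightarrow> (exp (- \<alpha> * - h) - exp (- \<alpha> * 0)) / h) (along T)"
      if "h > 0" for h
      by (intro tendsto_divide tendsto_diff Jshift tendsto_const; use that T in simp)+
    have "((\<lambda>x. C x / g x) \<longlongrightarrow> \<alpha>) (along T)"
    proof (rule order_tendstoI)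
      \<comment> \<open>Choose \<open>h\<close> so small that the limit of the lower bound already exceeds \<open>b\<close>.\<close>
      fix b assume b: "b < \<alpha>"
      have "((\<lambda>h. (exp (- \<alpha> * 0) - exp (- \<alpha> * h)) / h) \<longlongrightarrow> \<alpha>) (at_right 0)" using \<alpha> by real_asymp
      from order_tendstoD(1)[OF this b] have "\<forall>\<^sub>F h in at_right 0. b < (exp (- \<alpha> * 0) - exp (- \<alpha> * h)) / h \<and> h > 0"
        using eventually_at_right_less[of "0::real"] by eventually_elim auto
      then obtain h where h: "h > 0" "b < (exp (- \<alpha> * 0) - exp (- \<alpha> * h)) / h"
        using eventually_happens'[of "at_right (0::real)"] by force
      show "\<forall>\<^sub>F x in along T. b < C x / g x"
        using order_tendstoD(1)[OF lo[OF h(1)] h(2)] le[OF h(1)] by eventually_elim auto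
    next
      fix b assume b: "\<alpha> < b"
      have "((\<lambda>h. (exp (- \<alpha> * - h) - exp (- \<alpha> * 0)) / h) \<longlongrightarrow> \<alpha>) (at_right 0)" using \<alpha> by real_asymp
      from order_tendstoD(2)[OF this b] have "\<forall>\<^sub>F h in at_right 0. (exp (- \<alpha> * - h) - exp (- \<alpha> * 0)) / h < b \<and> h > 0"
        using eventually_at_right_less[of "0::real"] by eventually_elim auto
      then obtain h where h: "h > 0" "(exp (- \<alpha> * - h) - exp (- \<alpha> * 0)) / h < b"
        using eventually_happens'[of "at_right (0::real)"] by force
      show "\<forall>\<^sub>F x in along T. C x / g x < b"
        using order_tendstoD(2)[OF up[OF h(1)] h(2)] le[OF h(1)] by eventually_elim auto
    qed
    then show ?thesis using True by simp
  qed
  then show ?thesis by (simp add: C_def g_def w_def)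
qed

section \<open>Associated functions are slowly varying\<close>

lemma nn_integral_floor_eq_suminf:
  "(\<integral>\<^sup>+y\<in>{0::real..}. h (nat \<lfloor>y\<rfloor>) \<partial>lborel) = (\<Sum>k. h k :: ennreal)"
proof -
  have disj: "disjoint_family (\<lambda>k. {real k..<real k + 1})"
    unfolding disjoint_family_on_def by (auto simp: disjoint_iff)
  have "(\<integral>\<^sup>+y\<in>{0::real..}. h (nat \<lfloor>y\<rfloor>) \<partial>lborel) = (\<integral>\<^sup>+y. (\<Sum>k. h k * indicator {real k..<real k + 1} y) \<partial>lborel)"
  proof (intro nn_integral_cong)
    fix y :: real
    show "h (nat \<lfloor>y\<rfloor>) * indicator {0..} y = (\<Sum>k. h k * indicator {real k..<real k + 1} y)"
    proof (cases "y \<ge> 0")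
      case True
      then have "y \<in> {real (nat \<lfloor>y\<rfloor>)..<real (nat \<lfloor>y\<rfloor>) + 1}" by simp
      from suminf_cmult_indicator[OF disj this, of h] True show ?thesis by simp
    qed (auto simp: indicator_def)
  qed
  also have "\<dots> = (\<Sum>k. \<integral>\<^sup>+y. h k * indicator {real k..<real k + 1} y \<partial>lborel)"
    by (intro nn_integral_suminf) measurable
  also have "\<dots> = (\<Sum>k. h k)"
    by (simp add: nn_integral_cmult_indicator)
  finally show ?thesis .
qed

lemma infinite_integral_iff_suminf:
  assumes u: "slowly_varying u"
  shows "infinite_integral u \<longleftrightarrow> (\<Sum>k. ennreal (u (real k))) = \<infinity>"
proof -
  note [measurable] = slowly_varyingD(1)[OF u]
  define v where "v = (\<lambda>y :: real. u (real (nat \<lfloor>y\<rfloor>)))"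
  have mv: "v \<in> borel_measurable borel" unfolding v_def by measurable
  have iv: "infinite_integral v \<longleftrightarrow> (\<Sum>k. ennreal (u (real k))) = \<infinity>"
    unfolding infinite_integral_def v_def
    using nn_integral_floor_eq_suminf[of "\<lambda>k. ennreal (u (real k))"] by simp
  have bv: "\<exists>M\<ge>0. \<forall>x\<in>{0..B}. v x \<le> M" for B
  proof -
    obtain M where M: "M \<ge> 0" "\<And>x. x \<in> {0..B} \<Longrightarrow> u x \<le> M" using slowly_varyingD(3)[OF u, of B] by blast
    have "v x \<le> M" if "x \<in> {0..B}" for x
      using that unfolding v_def by (intro M(2)) (auto intro: order_trans[OF of_int_floor_le])
    then show ?thesis using M(1) by blast
  qed
  have "\<exists>K. \<forall>x\<ge>K. \<forall>t\<in>{0..1}. u (x + t) \<le> 2 * u x \<and> u x \<le> 2 * u (x + t)"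
    using slowly_varyingD(5)[OF u, of 1] by (simp add: eventually_at_top_linorder)
  then obtain K where K: "\<And>x t. x \<ge> K \<Longrightarrow> t \<in> {0..1} \<Longrightarrow> u (x + t) \<le> 2 * u x \<and> u x \<le> 2 * u (x + t)"
    by blast
  have "u y \<le> 2 * v y \<and> v y \<le> 2 * u y" if y: "y \<ge> max K 0 + 1" for y
  proof -
    define n where "n = real (nat \<lfloor>y\<rfloor>)"
    have n: "n \<ge> K" "y - n \<in> {0..1}" using y unfolding n_def by (auto; linarith)+
    from K[OF this] show ?thesis by (simp add: v_def n_def)
  qed
  then have uv: "\<forall>\<^sub>F y in at_top. u y \<le> 2 * v y" and vu: "\<forall>\<^sub>F y in at_top. v y \<le> 2 * u y"
    unfolding eventually_at_top_linorder by blast+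
  show ?thesis unfolding iv[symmetric]
    using infinite_integral_mono[OF slowly_varyingD(1)[OF u] slowly_varyingD(3)[OF u] mv _ _ uv]
      infinite_integral_mono[OF mv bv slowly_varyingD(1)[OF u] _ _ vu] by auto
qed

lemma slowly_varying_cmult:
  assumes u: "slowly_varying u" and c: "c > 0"
  shows "slowly_varying (\<lambda>x. c * u x)"
  unfolding slowly_varying_def
proof (intro conjI allI impI)
  show "(\<lambda>x. c * u x) \<in> borel_measurable borel" using slowly_varyingD(1)[OF u] by simp
  show "c * u x \<ge> 0" if "x \<ge> 0" for x using slowly_varyingD(2)[OF u that] c by simp
  show "\<exists>M. \<forall>x\<in>{0..B}. c * u x \<le> M" for B
    using slowly_varyingD(3)[OF u, of B] c by (metis less_imp_le mult_left_mono)
  show "\<forall>\<^sub>F x in at_top. c * u x > 0" using slowly_varyingD(4)[OF u] by eventually_elim (use c in simp)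
  fix e :: real assume "e > 0"
  from slowly_varyingD(5)[OF u this]
  show "\<forall>\<^sub>F x in at_top. \<forall>t\<in>{0..1}. c * u (x + t) \<le> (1 + e) * (c * u x) \<and> c * u x \<le> (1 + e) * (c * u (x + t))"
    by eventually_elim (use c in \<open>simp add: mult.left_commute[of _ c]\<close>)
qed

lemma infinite_integral_cmult:
  assumes u: "slowly_varying u" and c: "c > 0" and "infinite_integral u"
  shows "infinite_integral (\<lambda>x. c * u x)"
  by (rule infinite_integral_mono[OF slowly_varyingD(1,3)[OF u], where c = "1 / c"])
     (use assms slowly_varyingD(1)[OF u] in auto)

text \<open>The bounds obtained below lose a factor \<open>1 + d\<close> four times, with \<open>d\<close> arbitrary.\<close>

lemma slowly_varyingI:
  assumes m: "u \<in> borel_measurable borel" and nn: "\<And>x. x \<ge> 0 \<Longrightarrow> u x \<ge> 0"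
    and b: "\<And>B. \<exists>M. \<forall>x\<in>{0..B}. u x \<le> M" and p: "\<forall>\<^sub>F x in at_top. u x > 0"
    and step: "\<And>d. d > 0 \<Longrightarrow> \<forall>\<^sub>F x in at_top. \<forall>t\<in>{0..1}. u (x + t) \<le> (1 + d) ^ 4 * u x \<and> u x \<le> (1 + d) ^ 4 * u (x + t)"
  shows "slowly_varying u"
  unfolding slowly_varying_def
proof (intro conjI allI impI m nn b p)
  fix e :: real assume e: "e > 0"
  define d where "d = root 4 (1 + e) - 1"
  have "d > 0" "(1 + d) ^ 4 = 1 + e" using e by (auto simp: d_def)
  with step[of d] show "\<forall>\<^sub>F x in at_top. \<forall>t\<in>{0..1}. u (x + t) \<le> (1 + e) * u x \<and> u x \<le> (1 + e) * u (x + t)" by simp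
qed

lemma lin_interp_of_nat [simp]: "lin_interp f (real k) = f (real k)"
  by (simp add: lin_interp_def frac_def)

lemma
  assumes x: "real n \<le> x" "x < real n + 1"
  shows lin_interp_ge: "lo \<le> f (real n) \<Longrightarrow> lo \<le> f (real n + 1) \<Longrightarrow> lo \<le> lin_interp f x"
    and lin_interp_le: "f (real n) \<le> hi \<Longrightarrow> f (real n + 1) \<le> hi \<Longrightarrow> lin_interp f x \<le> hi"
proof -
  have fl: "\<lfloor>x\<rfloor> = int n" using x by linarith
  have eq: "lin_interp f x = (1 - frac x) * f (real n) + frac x * f (real n + 1)" by (simp add: lin_interp_def fl)
  have fr: "0 \<le> frac x" "0 \<le> 1 - frac x" using frac_lt_1[of x] by (auto simp: less_imp_le)
  show "lo \<le> lin_interp f x" if "lo \<le> f (real n)" "lo \<le> f (real n + 1)"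
  proof -
    have "(1 - frac x) * lo + frac x * lo \<le> lin_interp f x"
      unfolding eq using fr that by (intro add_mono mult_left_mono) auto
    then show ?thesis by (simp add: algebra_simps)
  qed
  show "lin_interp f x \<le> hi" if "f (real n) \<le> hi" "f (real n + 1) \<le> hi"
  proof -
    have "lin_interp f x \<le> (1 - frac x) * hi + frac x * hi"
      unfolding eq using fr that by (intro add_mono mult_left_mono) auto
    then show ?thesis by (simp add: algebra_simps)
  qed
qed

text \<open>For \<open>n = \<lfloor>x\<rfloor>\<close>, all values on \<open>[x, x + 1]\<close> are convex combinations of the values of \<open>f\<close>
  at \<open>n\<close>, \<open>n + 1\<close>, \<open>n + 2\<close>, and these three have ratios close to 1.\<close>

lemma slowly_varying_lin_interp:
  assumes nn: "\<And>k::nat. f (real k) \<ge> 0" and f: "f \<in> L_fun_int 0"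
  shows "slowly_varying (lin_interp f)"
proof (rule slowly_varyingI)
  have "(\<lambda>x. (1 - frac x) * f (of_int \<lfloor>x\<rfloor>) + frac x * f (of_int \<lfloor>x\<rfloor> + 1)) \<in> borel_measurable borel"
    unfolding frac_def by measurable
  then show "lin_interp f \<in> borel_measurable borel" by (simp add: lin_interp_def[abs_def])
  have nn1: "f (real k + 1) \<ge> 0" for k using nn[of "Suc k"] by (simp add: add.commute)
  have bracket: "real (nat \<lfloor>x\<rfloor>) \<le> x" "x < real (nat \<lfloor>x\<rfloor>) + 1" if "x \<ge> 0" for x using that by auto
  show "lin_interp f x \<ge> 0" if "x \<ge> 0" for x
    by (rule lin_interp_ge[OF bracket[OF that] nn nn1])
  show "\<exists>M. \<forall>x\<in>{0..B}. lin_interp f x \<le> M" for B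
  proof -
    \<comment> \<open>The upper index is \<open>\<lceil>B\<rceil> + 1\<close> because interpolation at \<open>x\<close> uses the value at \<open>\<lfloor>x\<rfloor> + 1\<close>.\<close>
    define M where "M = (\<Sum>j\<le>nat \<lceil>B\<rceil> + 1. f (real j))"
    have M: "f (real j) \<le> M" if "j \<le> nat \<lceil>B\<rceil> + 1" for j
      unfolding M_def using that nn by (intro member_le_sum) auto
    have "lin_interp f x \<le> M" if x: "x \<in> {0..B}" for x
    proof -
      have "nat \<lfloor>x\<rfloor> \<le> nat \<lceil>B\<rceil>" using x by (intro nat_mono order_trans[OF floor_mono floor_le_ceiling]) auto
      then have "f (real (nat \<lfloor>x\<rfloor>)) \<le> M" "f (real (nat \<lfloor>x\<rfloor>) + 1) \<le> M"
        using M[of "nat \<lfloor>x\<rfloor>"] M[of "Suc (nat \<lfloor>x\<rfloor>)"] by (auto simp: add.commute)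
      then show ?thesis using x by (intro lin_interp_le[OF bracket]) auto
    qed
    then show ?thesis by blast
  qed
  have pos: "\<forall>\<^sub>F k in sequentially. f (real k) > 0" using f by (simp add: L_fun_int_def)
  have ratio: "\<forall>\<^sub>F k in sequentially. f (real k) \<le> (1 + d) * f (real k + 1) \<and> f (real k + 1) \<le> (1 + d) * f (real k)" if d: "d > 0" for d
  proof -
    have "(\<lambda>k. f (real k - real 1)) \<sim>[sequentially] (\<lambda>k. exp (0 * real 1) * f (real k))"
      using f unfolding L_fun_int_def by blast
    then have "(\<lambda>k. f (real k - 1)) \<sim>[sequentially] (\<lambda>k. f (real k))" by simp
    then have "\<forall>\<^sub>F k in sequentially. f (real k - 1) \<le> (1 + d) * f (real k) \<and> f (real k) \<le> (1 + d) * f (real k - 1)"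
    proof (rule asymp_equiv_ratio_bounds[OF _ d])
      show "\<forall>\<^sub>F k in sequentially. f (real k - 1) \<ge> 0"
        using eventually_ge_at_top[of 1]
      proof eventually_elim
        case (elim k) then show ?case using nn[of "k - 1"] by (simp add: of_nat_diff)
      qed
    qed (simp_all add: nn)
    then have "\<forall>\<^sub>F k in sequentially. f (real (Suc k) - 1) \<le> (1 + d) * f (real (Suc k)) \<and> f (real (Suc k)) \<le> (1 + d) * f (real (Suc k) - 1)"
      by (rule eventually_compose_filterlim) (rule filterlim_Suc)
    then show ?thesis by (simp add: add.commute)
  qed
  have between: "\<exists>K. \<forall>x\<ge>K. \<forall>y\<in>{x..x + 1}. lin_interp f y \<le> (1 + d)\<^sup>2 * f (real (nat \<lfloor>x\<rfloor>)) \<and> f (real (nat \<lfloor>x\<rfloor>)) \<le> (1 + d)\<^sup>2 * lin_interp f y \<and> f (real (nat \<lfloor>x\<rfloor>)) > 0"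
    if d: "d > 0" for d
  proof -
    obtain K0 where K0: "\<And>k. k \<ge> K0 \<Longrightarrow> f (real k) \<le> (1 + d) * f (real k + 1) \<and> f (real k + 1) \<le> (1 + d) * f (real k) \<and> f (real k) > 0"
      using eventually_conj[OF ratio[OF d] pos] unfolding eventually_sequentially by blast
    have "lin_interp f y \<le> (1 + d)\<^sup>2 * f (real (nat \<lfloor>x\<rfloor>)) \<and> f (real (nat \<lfloor>x\<rfloor>)) \<le> (1 + d)\<^sup>2 * lin_interp f y \<and> f (real (nat \<lfloor>x\<rfloor>)) > 0"
      if x: "x \<ge> real K0 + 1" and y: "y \<in> {x..x + 1}" for x y
    proof -
      define n where "n = nat \<lfloor>x\<rfloor>"
      define A where "A = f (real n)"
      have n: "n \<ge> K0" "real n \<le> x" "x < real n + 1" using x by (auto simp: n_def le_nat_floor)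
      have A: "A > 0" using K0[OF n(1)] by (simp add: A_def)
      have q: "1 + d > 0" "1 + d \<ge> 1" "(1 + d)\<^sup>2 = (1 + d) * (1 + d)" using d by (auto simp: power2_eq_square)
      define hi where "hi = (1 + d)\<^sup>2 * A"
      define lo where "lo = A / (1 + d)\<^sup>2"
      have b1: "f (real n + 1) \<le> (1 + d) * A" "A \<le> (1 + d) * f (real n + 1)" using K0[OF n(1)] by (auto simp: A_def)
      have b2: "f (real n + 2) \<le> (1 + d) * f (real n + 1)" "f (real n + 1) \<le> (1 + d) * f (real n + 2)"
        using K0[of "Suc n"] n by (auto simp: add.commute add.left_commute)
      have h2: "f (real n + 2) \<le> hi" "A \<le> (1 + d)\<^sup>2 * f (real n + 2)"
        unfolding hi_def q(3) mult.assoc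
        using order_trans[OF b2(1) mult_left_mono[OF b1(1) less_imp_le[OF q(1)]]]
          order_trans[OF b1(2) mult_left_mono[OF b2(2) less_imp_le[OF q(1)]]] by blast+
      have m1: "(1 + d) * z \<le> (1 + d)\<^sup>2 * z" "z \<le> (1 + d)\<^sup>2 * z" if "z \<ge> 0" for z
      proof -
        show 1: "(1 + d) * z \<le> (1 + d)\<^sup>2 * z" unfolding q(3) mult.assoc
          using mult_right_mono[OF q(2), of "(1 + d) * z"] that q by simp
        show "z \<le> (1 + d)\<^sup>2 * z" using 1 mult_right_mono[OF q(2), of z] that by simp
      qed
      have h1: "f (real n + 1) \<le> hi" "A \<le> (1 + d)\<^sup>2 * f (real n + 1)"
        using order_trans[OF b1(1) m1(1)] order_trans[OF b1(2) m1(1)] A nn1[of n] by (auto simp: hi_def)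
      have h0: "f (real n) \<le> hi" "A \<le> (1 + d)\<^sup>2 * f (real n)" using m1(2)[of A] A by (auto simp: hi_def A_def)
      have l: "lo \<le> f (real n)" "lo \<le> f (real n + 1)" "lo \<le> f (real n + 2)"
        using h0 h1 h2 d by (auto simp: lo_def divide_le_eq mult.commute)
      have "lo \<le> lin_interp f y \<and> lin_interp f y \<le> hi"
      proof (cases "y < real n + 1")
        case True
        then show ?thesis using lin_interp_ge[of n y lo f] lin_interp_le[of n y f hi] l h0 h1 n y by auto
      next
        case False
        have "real (Suc n) = real n + 1" "real (Suc n) + 1 = real n + 2" by auto
        with False show ?thesis using lin_interp_ge[of "Suc n" y lo f] lin_interp_le[of "Suc n" y f hi] l h2 h1 n y by (auto simp: add.commute)
      qed
      then have "lin_interp f y \<le> (1 + d)\<^sup>2 * A \<and> A \<le> (1 + d)\<^sup>2 * lin_interp f y"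
        using d by (auto simp: lo_def hi_def divide_le_eq mult.commute)
      then show ?thesis using A by (simp add: A_def n_def)
    qed
    then show ?thesis by blast
  qed
  show "\<forall>\<^sub>F x in at_top. lin_interp f x > 0"
  proof -
    obtain K where "\<forall>x\<ge>K. \<forall>y\<in>{x..x + 1}. f (real (nat \<lfloor>x\<rfloor>)) \<le> (1 + 1)\<^sup>2 * lin_interp f y \<and> f (real (nat \<lfloor>x\<rfloor>)) > 0"
      using between[of 1] by auto
    then have "\<forall>x\<ge>K. lin_interp f x > 0" by force
    then show ?thesis unfolding eventually_at_top_linorder by blast
  qed
  fix d :: real assume d: "d > 0"
  obtain K where K: "\<And>x y. x \<ge> K \<Longrightarrow> y \<in> {x..x + 1} \<Longrightarrow> lin_interp f y \<le> (1 + d)\<^sup>2 * f (real (nat \<lfloor>x\<rfloor>)) \<and> f (real (nat \<lfloor>x\<rfloor>)) \<le> (1 + d)\<^sup>2 * lin_interp f y"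
    using between[OF d] by blast
  have q4: "(1 + d) ^ 4 = (1 + d)\<^sup>2 * (1 + d)\<^sup>2" by (simp add: power_add[symmetric])
  have main: "lin_interp f a \<le> (1 + d) ^ 4 * lin_interp f b" if "x \<ge> K" "a \<in> {x..x + 1}" "b \<in> {x..x + 1}" for x a b
  proof -
    have "lin_interp f a \<le> (1 + d)\<^sup>2 * f (real (nat \<lfloor>x\<rfloor>))" using K[OF that(1,2)] by blast
    also have "\<dots> \<le> (1 + d)\<^sup>2 * ((1 + d)\<^sup>2 * lin_interp f b)"
      using K[OF that(1,3)] by (intro mult_left_mono) auto
    finally show ?thesis by (simp only: q4 mult.assoc)
  qed
  show "\<forall>\<^sub>F x in at_top. \<forall>t\<in>{0..1}. lin_interp f (x + t) \<le> (1 + d) ^ 4 * lin_interp f x \<and> lin_interp f x \<le> (1 + d) ^ 4 * lin_interp f (x + t)"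
    using eventually_ge_at_top[of K]
  proof (rule eventually_mono)
    fix x assume "K \<le> x"
    note m = main[OF this]
    show "\<forall>t\<in>{0..1}. lin_interp f (x + t) \<le> (1 + d) ^ 4 * lin_interp f x \<and> lin_interp f x \<le> (1 + d) ^ 4 * lin_interp f (x + t)"
      by (intro ballI conjI m) auto
  qed
qed

text \<open>Uniformity comes from the monotonicity of the tail: \<open>g x = exp (\<alpha> x) * tail V x\<close> increases by a
  factor of at most \<open>exp (\<alpha> / N)\<close> over a distance of at most \<open>1 / N\<close>, so it is enough to control the
  ratios of \<open>f\<close> at the finitely many shifts \<open>j / N\<close>, where pointwise slow variation applies.\<close>

lemma slowly_varying_of_tail:
  assumes V: "real_distribution V" and \<alpha>: "\<alpha> > 0" and nn: "\<And>x. x \<ge> 0 \<Longrightarrow> f x \<ge> 0" and f: "f \<in> L_fun 0"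
    and bdd: "\<And>B. B \<subseteq> {0..} \<Longrightarrow> bounded B \<Longrightarrow> bounded (f ` B)"
    and tl: "tail V \<sim>[at_top] (\<lambda>x. exp (- \<alpha> * x) * f x)"
  shows "slowly_varying f"
proof (rule slowly_varyingI)
  show "f \<in> borel_measurable borel" "\<forall>\<^sub>F x in at_top. f x > 0" using f by (auto simp: L_fun_def)
  show "f x \<ge> 0" if "x \<ge> 0" for x by (rule nn[OF that])
  show "\<exists>M. \<forall>x\<in>{0..B}. f x \<le> M" for B
    using bdd[of "{0..B}"] unfolding bounded_iff by (force simp: abs_le_iff)
  fix d :: real assume d: "d > 0"
  define q where "q = 1 + d"
  have q: "q > 1" using d by (simp add: q_def)
  define g where "g = (\<lambda>x. exp (\<alpha> * x) * tail V x)"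
  have "\<forall>\<^sub>F x in at_top. tail V x \<le> q * (exp (- \<alpha> * x) * f x) \<and> exp (- \<alpha> * x) * f x \<le> q * tail V x"
    unfolding q_def using tail_nonneg[OF V]
    by (intro asymp_equiv_ratio_bounds[OF tl d]) (auto intro!: nn mult_nonneg_nonneg eventually_mono[OF eventually_ge_at_top[of 0]])
  then have gf: "\<forall>\<^sub>F x in at_top. g x \<le> q * f x \<and> f x \<le> q * g x"
  proof eventually_elim
    case (elim x)
    have "exp (\<alpha> * x) * tail V x \<le> exp (\<alpha> * x) * (q * (exp (- \<alpha> * x) * f x))"
      "exp (\<alpha> * x) * (exp (- \<alpha> * x) * f x) \<le> exp (\<alpha> * x) * (q * tail V x)"
      using elim by (auto intro: mult_left_mono)
    then show ?case by (simp add: g_def exp_minus field_simps)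
  qed
  obtain N :: nat where N: "N > 0" "exp (\<alpha> / N) \<le> q"
  proof -
    obtain N :: nat where N: "\<alpha> / ln q < real N" using reals_Archimedean2 by blast
    have "N > 0" using N q \<alpha> by (metis divide_pos_pos gr0I ln_gt_zero of_nat_0 order_less_asym)
    moreover from this have "\<alpha> / N \<le> ln q" using N q by (simp add: field_simps)
    then have "exp (\<alpha> / N) \<le> q" using q by (metis exp_le_cancel_iff exp_ln less_trans zero_less_one)
    ultimately show ?thesis using that by blast
  qed
  have shift: "\<forall>\<^sub>F x in at_top. f (x + t) \<le> q * f x \<and> f x \<le> q * f (x + t)" for t
  proof -
    have "(\<lambda>x. f (x - (- t))) \<sim>[at_top] (\<lambda>x. exp (0 * (- t)) * f x)" using f unfolding L_fun_def by blast
    then show ?thesis unfolding q_def 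
      by (intro asymp_equiv_ratio_bounds[OF _ d])
        (auto intro!: nn eventually_mono[OF eventually_ge_at_top[of "max 0 (- t)"]])
  qed
  have "\<forall>\<^sub>F x in at_top. \<forall>j\<in>{..Suc N}. f (x + real j / real N) \<le> q * f x \<and> f x \<le> q * f (x + real j / real N)"
    by (intro eventually_ball_finite ballI shift) auto
  then have "\<forall>\<^sub>F x in at_top. (g x \<le> q * f x \<and> f x \<le> q * g x) \<and> (\<forall>j\<in>{..Suc N}. f (x + real j / real N) \<le> q * f x \<and> f x \<le> q * f (x + real j / real N))"
    using gf by eventually_elim blast
  then obtain K where K: "\<And>x. x \<ge> K \<Longrightarrow> g x \<le> q * f x \<and> f x \<le> q * g x"
     "\<And>x j. x \<ge> K \<Longrightarrow> j \<le> Suc N \<Longrightarrow> f (x + real j / real N) \<le> q * f x \<and> f x \<le> q * f (x + real j / real N)"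
    unfolding eventually_at_top_linorder by (metis atMost_iff)
  have gstep: "g y \<le> q * g z" if "z \<le> y" "y \<le> z + 1 / real N" for y z
  proof -
    have "\<alpha> * y \<le> \<alpha> / N + \<alpha> * z" using mult_left_mono[OF that(2), of \<alpha>] \<alpha> by (simp add: algebra_simps)
    then have "exp (\<alpha> * y) \<le> exp (\<alpha> / N) * exp (\<alpha> * z)" by (simp add: exp_add[symmetric])
    also have "\<dots> \<le> q * exp (\<alpha> * z)" using N by (intro mult_right_mono) auto
    finally have "exp (\<alpha> * y) * tail V y \<le> (q * exp (\<alpha> * z)) * tail V z"
      using tail_antimono[OF V that(1)] tail_nonneg[OF V] q by (intro mult_mono) auto
    then show ?thesis by (simp add: g_def mult.assoc)
  qed
  have main: "f (x + t) \<le> q ^ 4 * f x \<and> f x \<le> q ^ 4 * f (x + t)" if x: "x \<ge> K" and t: "t \<in> {0..1}" for x t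
  proof -
    define j where "j = nat \<lfloor>t * real N\<rfloor>"
    have "t * real N \<le> 1 * real N" using t by (intro mult_right_mono) auto
    then have jN: "j \<le> N" by (simp add: j_def nat_le_iff floor_le_iff)
    have j: "real j \<le> t * real N" "t * real N \<le> real j + 1" using t by (auto simp: j_def)
    then have jt: "real j / real N \<le> t" "t \<le> real j / real N + 1 / real N" "real (Suc j) / real N = real j / real N + 1 / real N"
      using N(1) by (auto simp: field_simps)
    define s where "s = real j / real N"
    have s: "s \<ge> 0" "s \<le> t" "t \<le> s + 1 / real N" "1 / real N \<ge> 0" using jt by (auto simp: s_def)
    have "f (x + t) \<le> q * g (x + t)" using K(1)[of "x + t"] x t by auto
    also have "\<dots> \<le> q * (q * g (x + s))" using s q by (intro mult_left_mono gstep) auto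
    also have "\<dots> \<le> q * (q * (q * f (x + s)))" using K(1)[of "x + s"] x s q by (intro mult_left_mono) auto
    also have "\<dots> \<le> q * (q * (q * (q * f x)))" using K(2)[of x j] x s q jN by (intro mult_left_mono) (auto simp: s_def)
    finally have 1: "f (x + t) \<le> q ^ 4 * f x" by (simp add: power4_eq_xxxx mult.assoc)
    have "f x \<le> q * f (x + (s + 1 / real N))" using K(2)[of x "Suc j"] x jN by (simp only: jt(3) s_def)
    also have "\<dots> \<le> q * (q * g (x + (s + 1 / real N)))" using K(1)[of "x + (s + 1 / real N)"] x s q by (intro mult_left_mono) auto
    also have "\<dots> \<le> q * (q * (q * g (x + t)))" using s q by (intro mult_left_mono gstep) auto
    also have "\<dots> \<le> q * (q * (q * (q * f (x + t))))" using K(1)[of "x + t"] x t q by (intro mult_left_mono) auto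
    finally show ?thesis using 1 by (simp add: power4_eq_xxxx mult.assoc)
  qed
  then show "\<forall>\<^sub>F x in at_top. \<forall>t\<in>{0..1}. f (x + t) \<le> (1 + d) ^ 4 * f x \<and> f x \<le> (1 + d) ^ 4 * f (x + t)"
    unfolding eventually_at_top_linorder q_def by blast
qed

section \<open>The class \<open>L1_dist\<close> and its closure under convolution\<close>

text \<open>The arguments along which the asymptotic relations for \<open>V\<close> are meant.\<close>

definition support_set :: "real measure \<Rightarrow> real set" where
  "support_set V = (if lattice_dist V then \<int> else UNIV)"

lemma support_set_cases: "support_set V \<in> {UNIV, \<int>}"
  by (simp add: support_set_def)

lemma arg_filter_eq_along: "arg_filter D = along (if \<exists>V\<in>D. lattice_dist V then \<int> else UNIV)"
  by (simp add: arg_filter_def along_Ints)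

lemma asymp_equiv_along_Ints:
  "f \<sim>[along \<int>] g \<longleftrightarrow> (\<lambda>k. f (real k)) \<sim>[sequentially] (\<lambda>k. g (real k))"
  by (simp add: along_Ints asymp_equiv_filtermap_iff)

text \<open>A version of being associated in which \<open>u\<close> is slowly varying along all real numbers, also for
  lattice distributions. Only in this form the class is closed under convolution with \<open>otimes\<close>:
  the convolution integral of two interpolated functions is not itself an interpolation.\<close>

definition exponential_tail :: "real \<Rightarrow> real measure \<Rightarrow> (real \<Rightarrow> real) \<Rightarrow> bool" where
  "exponential_tail \<alpha> V u \<longleftrightarrow> real_distribution V \<and> (lattice_dist V \<longrightarrow> unit_lattice V) \<and>
     slowly_varying u \<and> infinite_integral u \<and>
     tail V \<sim>[along (support_set V)] (\<lambda>x. exp (- \<alpha> * x) * u x)"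

lemma associated_extended:
  assumes V: "real_distribution V" and \<alpha>: "\<alpha> > 0" and f: "associated \<alpha> V f"
  shows "slowly_varying (extended V f)"
    and "tail V \<sim>[along (support_set V)] (\<lambda>x. exp (- \<alpha> * x) * extended V f x)"
    and "infinite_mass V f \<longleftrightarrow> infinite_integral (extended V f)"
proof -
  show sv: "slowly_varying (extended V f)"
  proof (cases "lattice_dist V")
    case True
    then have "\<And>k::nat. f (real k) \<ge> 0" "f \<in> L_fun_int 0" using f by (simp_all add: associated_def)
    then have "slowly_varying (lin_interp f)" by (rule slowly_varying_lin_interp)
    then show ?thesis using True by (simp add: extended_def)
  next
    case False
    then have "\<And>x. x \<ge> 0 \<Longrightarrow> f x \<ge> 0" "f \<in> L_fun 0" "\<And>B. B \<subseteq> {0..} \<Longrightarrow> bounded B \<Longrightarrow> bounded (f ` B)"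
      "tail V \<sim>[at_top] (\<lambda>x. exp (- \<alpha> * x) * f x)" using f by (simp_all add: associated_def)
    then have "slowly_varying f" by (rule slowly_varying_of_tail[OF V \<alpha>])
    then show ?thesis using False by (simp add: extended_def)
  qed
  show "tail V \<sim>[along (support_set V)] (\<lambda>x. exp (- \<alpha> * x) * extended V f x)"
    using f by (auto simp: associated_def extended_def support_set_def asymp_equiv_along_Ints split: if_splits)
  show "infinite_mass V f \<longleftrightarrow> infinite_integral (extended V f)"
  proof (cases "lattice_dist V")
    case True
    then show ?thesis using infinite_integral_iff_suminf[OF sv] by (simp add: infinite_mass_def extended_def)
  next
    case False
    then show ?thesis by (simp add: infinite_mass_def extended_def infinite_integral_def)
  qed
qed

text \<open>The infinite mass in the definition of \<open>L1_dist\<close> concerns some associated function; it carries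
  over to the given one, since the two are comparable along \<open>S\<close> and hence, by slow variation,
  everywhere near infinity.\<close>

lemma exponential_tail_extended:
  assumes \<alpha>: "\<alpha> > 0" and V: "V \<in> L1_dist \<alpha>" and f: "associated \<alpha> V f"
  shows "exponential_tail \<alpha> V (extended V f)"
proof -
  have RV: "real_distribution V" and lat: "lattice_dist V \<longrightarrow> unit_lattice V"
    using V by (auto simp: L1_dist_def L_dist_def split: if_splits)
  obtain f' where f': "associated \<alpha> V f'" "infinite_mass V f'" using V by (auto simp: L1_dist_def)
  define u where "u = extended V f"
  define u' where "u' = extended V f'"
  define S where "S = support_set V"
  have S: "S \<in> {UNIV, \<int>}" unfolding S_def by (rule support_set_cases)
  note u = associated_extended(1,2)[OF RV \<alpha> f, folded u_def S_def]
  note u' = associated_extended(1,2)[OF RV \<alpha> f'(1), folded u'_def S_def]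
  have inf': "infinite_integral u'" using associated_extended(3)[OF RV \<alpha> f'(1)] f'(2) by (simp add: u'_def)
  have bounds: "\<forall>\<^sub>F x in along S. tail V x \<le> 2 * (exp (- \<alpha> * x) * w x) \<and> exp (- \<alpha> * x) * w x \<le> 2 * tail V x"
    if "slowly_varying w" "tail V \<sim>[along S] (\<lambda>x. exp (- \<alpha> * x) * w x)" for w
    using tail_ratio_bounds[OF RV that, of 1] by simp
  have "\<forall>\<^sub>F x in along S. u' x \<le> 4 * u x"
    using bounds[OF u] bounds[OF u']
  proof eventually_elim
    case (elim x)
    then have "exp (- \<alpha> * x) * u' x \<le> 2 * tail V x" "tail V x \<le> 2 * (exp (- \<alpha> * x) * u x)" by blast+
    then have "exp (- \<alpha> * x) * u' x \<le> 4 * (exp (- \<alpha> * x) * u x)" by linarith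
    then have "exp (- \<alpha> * x) * u' x \<le> exp (- \<alpha> * x) * (4 * u x)" by (simp only: mult.left_commute)
    then show ?case by (simp only: mult_le_cancel_left_pos exp_gt_zero)
  qed
  then have "\<forall>\<^sub>F x in at_top. (x \<in> S \<longrightarrow> u' x \<le> 4 * u x) \<and> (\<forall>t\<in>{0..1}. u' (x + t) \<le> 2 * u' x) \<and> (\<forall>t\<in>{0..1}. u x \<le> 2 * u (x + t))"
    unfolding eventually_along
    using slowly_varyingD(5)[OF u(1), of 1, simplified] slowly_varyingD(5)[OF u'(1), of 1, simplified]
    by eventually_elim blast
  then obtain K where K: "\<And>x. x \<ge> K \<Longrightarrow> (x \<in> S \<longrightarrow> u' x \<le> 4 * u x) \<and> (\<forall>t\<in>{0..1}. u' (x + t) \<le> 2 * u' x) \<and> (\<forall>t\<in>{0..1}. u x \<le> 2 * u (x + t))"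
    unfolding eventually_at_top_linorder by blast
  have "u' x \<le> 16 * u x" if x: "x \<ge> K + 1" for x
  proof -
    define y where "y = round_down S x"
    have y: "y \<in> S" "y \<ge> K" "x - y \<in> {0..1}" using round_down[OF S, of x] x by (auto simp: y_def)
    have "u' (y + (x - y)) \<le> 2 * u' y" "u y \<le> 2 * u (y + (x - y))" "u' y \<le> 4 * u y" using K[OF y(2)] y(1,3) by blast+
    then show ?thesis by simp
  qed
  then have "\<forall>\<^sub>F x in at_top. u' x \<le> 16 * u x" unfolding eventually_at_top_linorder by blast
  from infinite_integral_mono[OF slowly_varyingD(1,3)[OF u'(1)] slowly_varyingD(1)[OF u(1)] inf' _ this]
  have "infinite_integral u" by simp
  then show ?thesis using RV lat u by (simp add: exponential_tail_def u_def S_def)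
qed

lemma slowly_varying_shift_asymp:
  assumes "slowly_varying u"
  shows "(\<lambda>x. u (x - t)) \<sim>[at_top] u"
  using slowly_varying_shift_tendsto[OF assms, of "- t"] by (intro asymp_equivI') simp

lemma exponential_tail_shift:
  assumes V: "exponential_tail \<alpha> V u" and t: "t \<in> support_set V"
  shows "(\<lambda>x. tail V (x - t)) \<sim>[along (support_set V)] (\<lambda>x. exp (\<alpha> * t) * tail V x)"
proof -
  define S where "S = support_set V"
  have tl: "tail V \<sim>[along S] (\<lambda>x. exp (- \<alpha> * x) * u x)" and u: "slowly_varying u"
    using V by (auto simp: exponential_tail_def S_def)
  have "filterlim (\<lambda>x. x + - t) (along S) (along S)"
  proof (rule filterlim_along_shift)
    fix x assume "x \<in> S"
    moreover have "t \<in> S" "S = UNIV \<or> S = \<int>" using t support_set_cases[of V] by (simp_all add: S_def)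
    ultimately show "x + - t \<in> S" by (elim disjE) (auto intro: Ints_add Ints_minus)
  qed
  then have "filterlim (\<lambda>x. x - t) (along S) (along S)" by simp
  from asymp_equiv_compose'[OF tl this]
  have "(\<lambda>x. tail V (x - t)) \<sim>[along S] (\<lambda>x. exp (- \<alpha> * (x - t)) * u (x - t))" .
  also have "(\<lambda>x. exp (- \<alpha> * (x - t)) * u (x - t)) \<sim>[along S] (\<lambda>x. exp (- \<alpha> * (x - t)) * u x)"
    by (intro asymp_equiv_mult asymp_equiv_refl asymp_equiv_filter_mono[OF along_le_at_top slowly_varying_shift_asymp[OF u]])
  also have "(\<lambda>x. exp (- \<alpha> * (x - t)) * u x) = (\<lambda>x. exp (\<alpha> * t) * (exp (- \<alpha> * x) * u x))"
  proof
    fix x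
    have "- \<alpha> * (x - t) = \<alpha> * t + - \<alpha> * x" by (simp add: algebra_simps)
    then show "exp (- \<alpha> * (x - t)) * u x = exp (\<alpha> * t) * (exp (- \<alpha> * x) * u x)"
      by (simp only: exp_add mult.assoc)
  qed
  also have "(\<lambda>x. exp (\<alpha> * t) * (exp (- \<alpha> * x) * u x)) \<sim>[along S] (\<lambda>x. exp (\<alpha> * t) * tail V x)"
    by (intro asymp_equiv_mult asymp_equiv_refl asymp_equiv_symI[OF tl])
  finally show ?thesis by (simp add: S_def)
qed

lemma L1_dist_of_exponential_tail:
  assumes V: "exponential_tail \<alpha> V u"
  shows "V \<in> L1_dist \<alpha>"
proof -
  have RV: "real_distribution V" and lat: "lattice_dist V \<longrightarrow> unit_lattice V" and u: "slowly_varying u" "infinite_integral u"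
    and tl: "tail V \<sim>[along (support_set V)] (\<lambda>x. exp (- \<alpha> * x) * u x)"
    using V by (auto simp: exponential_tail_def)
  have "\<forall>\<^sub>F x in along (support_set V). exp (- \<alpha> * x) * u x \<le> (1 + 1) * tail V x"
    using tail_ratio_bounds[OF RV u(1) tl zero_less_one] by eventually_elim blast
  moreover have "\<forall>\<^sub>F x in along (support_set V). u x > 0"
    by (rule filter_leD[OF along_le_at_top slowly_varyingD(4)[OF u(1)]])
  ultimately have pos: "\<forall>\<^sub>F x in along (support_set V). tail V x > 0"
  proof eventually_elim
    case (elim x)
    then have "0 < exp (- \<alpha> * x) * u x" by simp
    then have "0 < (1 + 1) * tail V x" using elim(1) by (rule less_le_trans)
    then show ?case by simp
  qed
  note shift = exponential_tail_shift[OF V]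
  have ushift: "(\<lambda>x. u (x - t)) \<sim>[at_top] (\<lambda>x. exp (0 * t) * u x)" for t
    using slowly_varying_shift_asymp[OF u(1), of t] by simp
  have ld: "V \<in> L_dist \<alpha>" and ass: "associated \<alpha> V u"
  proof -
    have "V \<in> L_dist \<alpha> \<and> associated \<alpha> V u"
    proof (cases "lattice_dist V")
      case True
      then have S: "support_set V = \<int>" by (simp add: support_set_def)
      have "(\<lambda>k. tail V (real k - real i)) \<sim>[sequentially] (\<lambda>k. exp (\<alpha> * real i) * tail V (real k))" for i
        using shift[of "real i"] by (simp add: S asymp_equiv_along_Ints)
      moreover have "\<forall>\<^sub>F k in sequentially. tail V (real k) > 0"
        using pos by (simp add: S along_Ints eventually_filtermap)
      moreover have "(\<lambda>k. u (real k - real i)) \<sim>[sequentially] (\<lambda>k. exp (0 * real i) * u (real k))" for i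
        using asymp_equiv_filter_mono[OF along_le_at_top[of \<int>] ushift[of "real i"]] by (simp add: asymp_equiv_along_Ints)
      moreover have "\<forall>\<^sub>F k in sequentially. u (real k) > 0"
        using filter_leD[OF along_le_at_top[of \<int>] slowly_varyingD(4)[OF u(1)]] by (simp add: along_Ints eventually_filtermap)
      ultimately show ?thesis using True lat RV tl slowly_varyingD(2)[OF u(1)]
        by (auto simp: L_dist_def associated_def L_fun_int_def S asymp_equiv_along_Ints)
    next
      case False
      then have S: "support_set V = UNIV" by (simp add: support_set_def)
      have "bounded (u ` B)" if B: "B \<subseteq> {0..}" "bounded B" for B
      proof -
        obtain b where b: "\<And>x. x \<in> B \<Longrightarrow> \<bar>x\<bar> \<le> b" using B(2) by (auto simp: bounded_iff)
        obtain M where M: "\<And>x. x \<in> {0..b} \<Longrightarrow> u x \<le> M" using slowly_varyingD(3)[OF u(1), of b] by blast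
        have "\<bar>u x\<bar> \<le> M" if "x \<in> B" for x
          using b[OF that] that B(1) M[of x] slowly_varyingD(2)[OF u(1), of x] by auto
        then show ?thesis by (auto simp: bounded_iff)
      qed
      then show ?thesis
        using False RV tl slowly_varyingD(1,2,4)[OF u(1)] shift ushift pos tail_measurable[OF RV]
        by (auto simp: L_dist_def associated_def L_fun_def S)
    qed
    then show "V \<in> L_dist \<alpha>" "associated \<alpha> V u" by auto
  qed
  moreover have "infinite_mass V u"
    using u infinite_integral_iff_suminf[OF u(1)] by (auto simp: infinite_mass_def infinite_integral_def)
  ultimately show ?thesis by (auto simp: L1_dist_def)
qed

lemma AE_convolution_iff:
  assumes V: "real_distribution V" and W: "real_distribution W" and A: "A \<in> sets borel"
  shows "(AE z in V \<star> W. z \<in> A) \<longleftrightarrow> (AE a in V. AE b in W. a + b \<in> A)"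
proof -
  interpret V: real_distribution V by fact
  interpret W: real_distribution W by fact
  interpret P: pair_prob_space V W ..
  have [measurable_cong]: "sets V = sets borel" "sets W = sets borel" by simp_all
  note [measurable] = A
  have "(AE z in V \<star> W. z \<in> A) \<longleftrightarrow> (AE p in V \<Otimes>\<^sub>M W. fst p + snd p \<in> A)"
    unfolding convolution_def by (subst AE_distr_iff) (auto simp: case_prod_beta A)
  also have "\<dots> \<longleftrightarrow> (AE a in V. AE b in W. a + b \<in> A)"
    by (rule P.AE_pair_iff[symmetric]) measurable
  finally show ?thesis .
qed

lemma lattice_set_borel: "{x :: real. \<exists>k::int. x = c + h * of_int k} \<in> sets borel"
proof -
  have "{x :: real. \<exists>k::int. x = c + h * of_int k} = range (\<lambda>k::int. c + h * of_int k)" by auto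
  moreover have "range (\<lambda>k::int. c + h * of_int k) \<in> sets borel"
    by (rule sets.countable) auto
  ultimately show ?thesis by (simp only:)
qed

text \<open>Fix a typical value of the first summand.\<close>

lemma concentrated_on_lattice_summand:
  assumes V: "real_distribution V" and W: "real_distribution W" and c: "concentrated_on_lattice c h (V \<star> W)"
  shows "\<exists>c'. concentrated_on_lattice c' h W"
proof -
  interpret V: real_distribution V by fact
  have "AE a in V. AE b in W. \<exists>k::int. a + b = c + h * of_int k"
    using c AE_convolution_iff[OF V W lattice_set_borel[of c h]] by (simp add: concentrated_on_lattice_def)
  then obtain a where "AE b in W. \<exists>k::int. a + b = c + h * of_int k"
    using eventually_happens'[OF V.ae_filter_bot] by blast
  then have "concentrated_on_lattice (c - a) h W"
    unfolding concentrated_on_lattice_def by (rule eventually_mono) (auto simp: algebra_simps)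
  then show ?thesis by blast
qed

lemma convolution_comm:
  assumes V: "real_distribution V" and W: "real_distribution W"
  shows "(V \<star> W) = (W \<star> V)"
proof -
  interpret V: real_distribution V by fact
  interpret W: real_distribution W by fact
  show ?thesis
    by (intro convolution_commutative) (auto simp: V.finite_measure_axioms W.finite_measure_axioms)
qed

lemma unit_lattice_imp_lattice: "unit_lattice V \<Longrightarrow> lattice_dist V"
  unfolding lattice_dist_def unit_lattice_def concentrated_on_lattice_def
  by (intro exI[of _ 0] exI[of _ 1]) (auto elim!: eventually_mono Nats_cases intro: exI[of _ "int _"])

lemma lattice_convolution:
  assumes V: "real_distribution V" and W: "real_distribution W"
    and lV: "lattice_dist V \<longrightarrow> unit_lattice V" and lW: "lattice_dist W \<longrightarrow> unit_lattice W"
  shows "lattice_dist (V \<star> W) \<longleftrightarrow> lattice_dist V \<and> lattice_dist W"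
    and "lattice_dist (V \<star> W) \<longrightarrow> unit_lattice (V \<star> W)"
proof -
  have imp: "lattice_dist (V \<star> W) \<Longrightarrow> lattice_dist V \<and> lattice_dist W"
    using concentrated_on_lattice_summand[OF V W] concentrated_on_lattice_summand[OF W V]
    unfolding lattice_dist_def convolution_comm[OF V W] by metis
  have un: "unit_lattice (V \<star> W)" if "lattice_dist V" "lattice_dist W"
  proof -
    have uV: "unit_lattice V" and uW: "unit_lattice W" using that lV lW by auto
    have nat: "(\<nat> :: real set) \<in> sets borel" by (simp add: Nats_def sets.countable)
    have "AE a in V. AE b in W. a + b \<in> \<nat>"
      using uV uW unfolding unit_lattice_def by (auto elim!: eventually_mono)
    then have "AE z in V \<star> W. z \<in> \<nat>" using AE_convolution_iff[OF V W nat] by simp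
    moreover have "h \<le> 1" if "h > 0" "concentrated_on_lattice c h (V \<star> W)" for c h
      using concentrated_on_lattice_summand[OF V W that(2)] uW that(1) by (auto simp: unit_lattice_def)
    ultimately show ?thesis by (auto simp: unit_lattice_def)
  qed
  show "lattice_dist (V \<star> W) \<longleftrightarrow> lattice_dist V \<and> lattice_dist W"
    using imp un unit_lattice_imp_lattice by blast
  then show "lattice_dist (V \<star> W) \<longrightarrow> unit_lattice (V \<star> W)" using un by blast
qed

lemma support_set_convolution:
  assumes "exponential_tail \<alpha> V u" "exponential_tail \<alpha> W v"
  shows "support_set (V \<star> W) = support_set V \<union> support_set W"
  using assms lattice_convolution(1)[of V W] by (auto simp: support_set_def exponential_tail_def)

definition tail_factor :: "real \<Rightarrow> real measure \<Rightarrow> real measure \<Rightarrow> real" where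
  "tail_factor \<alpha> V W = (if lattice_dist V \<or> lattice_dist W then exp \<alpha> - 1 else \<alpha>)"

lemma AE_support_set:
  assumes "lattice_dist V \<longrightarrow> unit_lattice V"
  shows "AE a in V. a \<in> support_set V"
  using assms by (auto simp: support_set_def unit_lattice_def Nats_subset_Ints[THEN subsetD] elim!: eventually_mono)

text \<open>If only the second distribution is lattice, the two are exchanged.\<close>

lemma exponential_tail_convolution:
  assumes \<alpha>: "\<alpha> > 0" and V: "exponential_tail \<alpha> V u" and W: "exponential_tail \<alpha> W v"
  shows "exponential_tail \<alpha> (V \<star> W) (\<lambda>x. tail_factor \<alpha> V W * otimes u v x)"
proof -
  have ratio: "((\<lambda>x. tail (V \<star> W) x / (exp (- \<alpha> * x) * otimes u v x)) \<longlongrightarrow> tail_factor \<alpha> V W) (along (support_set (V \<star> W)))"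
    if V: "exponential_tail \<alpha> V u" and W: "exponential_tail \<alpha> W v" and sub: "support_set V \<subseteq> support_set W" for V W u v
  proof -
    have "((\<lambda>x. tail (V \<star> W) x / (exp (- \<alpha> * x) * otimes v u x)) \<longlongrightarrow> (if support_set V = UNIV then \<alpha> else exp \<alpha> - 1)) (along (support_set W))"
      by (rule convolution_tail_tendsto[OF \<alpha>])
         (use V W sub support_set_cases AE_support_set in \<open>auto simp: exponential_tail_def\<close>)
    moreover have "support_set W = support_set (V \<star> W)" using support_set_convolution[OF V W] sub by auto
    moreover have "(if support_set V = UNIV then \<alpha> else exp \<alpha> - 1) = tail_factor \<alpha> V W"
      using sub by (auto simp: tail_factor_def support_set_def split: if_splits)
    ultimately show ?thesis by (simp add: otimes_commute[of v u])
  qed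
  have RV: "real_distribution V" and RW: "real_distribution W" using V W by (auto simp: exponential_tail_def)
  have lim: "((\<lambda>x. tail (V \<star> W) x / (exp (- \<alpha> * x) * otimes u v x)) \<longlongrightarrow> tail_factor \<alpha> V W) (along (support_set (V \<star> W)))"
  proof (cases "support_set V \<subseteq> support_set W")
    case False
    then have "support_set W \<subseteq> support_set V" by (auto simp: support_set_def split: if_splits)
    from ratio[OF W V this] show ?thesis
      by (simp add: convolution_comm[OF RV RW] otimes_commute[of u v] tail_factor_def disj_commute)
  qed (rule ratio[OF V W])
  have \<kappa>: "tail_factor \<alpha> V W > 0" using \<alpha> by (simp add: tail_factor_def)
  have sv: "slowly_varying (otimes u v)" and inf: "infinite_integral (otimes u v)"
    using V W by (auto simp: exponential_tail_def intro: slowly_varying_otimes infinite_integral_otimes)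
  have "tail (V \<star> W) \<sim>[along (support_set (V \<star> W))] (\<lambda>x. tail_factor \<alpha> V W * (exp (- \<alpha> * x) * otimes u v x))"
    using lim \<kappa> by (intro asymp_equivI'_const) auto
  then have "tail (V \<star> W) \<sim>[along (support_set (V \<star> W))] (\<lambda>x. exp (- \<alpha> * x) * (tail_factor \<alpha> V W * otimes u v x))"
    by (simp add: mult.left_commute)
  then show ?thesis
    using V W slowly_varying_cmult[OF sv \<kappa>] infinite_integral_cmult[OF sv \<kappa> inf] real_distribution_convolution[OF RV RW]
      lattice_convolution(2)[OF RV RW]
    by (auto simp: exponential_tail_def)
qed

text \<open>The tail of \<open>V\<close> is of order \<open>exp (- \<alpha> x) u x\<close>, and \<open>u\<close> is dominated by \<open>u \<otimes> v\<close>.\<close>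

lemma tail_smallo_convolution:
  assumes \<alpha>: "\<alpha> > 0" and V: "exponential_tail \<alpha> V u" and W: "exponential_tail \<alpha> W v"
  shows "tail V \<in> o[along (support_set (V \<star> W))](tail (V \<star> W))"
proof (rule landau_o.smallI)
  fix c :: real assume c: "c > 0"
  define \<kappa> where "\<kappa> = tail_factor \<alpha> V W"
  have \<kappa>: "\<kappa> > 0" using \<alpha> by (simp add: tail_factor_def \<kappa>_def)
  note VW = exponential_tail_convolution[OF \<alpha> V W]
  have RV: "real_distribution V" and RVW: "real_distribution (V \<star> W)" and u: "slowly_varying u" and v: "slowly_varying v"
    and inf: "infinite_integral v" and tV: "tail V \<sim>[along (support_set V)] (\<lambda>x. exp (- \<alpha> * x) * u x)"
    using V W VW by (auto simp: exponential_tail_def)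
  have w: "slowly_varying (\<lambda>x. \<kappa> * otimes u v x)" and
    tVW: "tail (V \<star> W) \<sim>[along (support_set (V \<star> W))] (\<lambda>x. exp (- \<alpha> * x) * (\<kappa> * otimes u v x))"
    using VW by (auto simp: exponential_tail_def \<kappa>_def)
  obtain c1 where c1: "c1 > 0" "\<forall>\<^sub>F x in at_top. tail V x \<le> c1 * (exp (- \<alpha> * x) * u x)"
    using real_tail_bound[OF RV u support_set_cases tV \<alpha>] by blast
  \<comment> \<open>The factor 2 accounts for replacing the tail of the convolution by its asymptotic value.\<close>
  define B where "B = 2 * c1 / (c * \<kappa>)"
  have B: "B \<ge> 0" using c1 c \<kappa> by (simp add: B_def)
  have "\<forall>\<^sub>F x in along (support_set (V \<star> W)). tail (V \<star> W) x \<le> (1 + 1) * (exp (- \<alpha> * x) * (\<kappa> * otimes u v x)) \<and>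
      exp (- \<alpha> * x) * (\<kappa> * otimes u v x) \<le> (1 + 1) * tail (V \<star> W) x"
    by (rule tail_ratio_bounds[OF RVW w tVW zero_less_one])
  then show "\<forall>\<^sub>F x in along (support_set (V \<star> W)). norm (tail V x) \<le> c * norm (tail (V \<star> W) x)"
    using filter_leD[OF along_le_at_top c1(2)]
      filter_leD[OF along_le_at_top otimes_dominates[OF v u inf B]]
  proof eventually_elim
    case (elim x)
    have "B * u x \<le> otimes u v x" using elim(3) by (simp add: otimes_commute[of v u])
    then have "2 * c1 * u x \<le> c * (\<kappa> * otimes u v x)" using c \<kappa> by (simp add: B_def field_simps)
    then have "exp (- \<alpha> * x) * (2 * c1 * u x) \<le> exp (- \<alpha> * x) * (c * (\<kappa> * otimes u v x))" by (intro mult_left_mono) auto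
    also have "\<dots> = c * (exp (- \<alpha> * x) * (\<kappa> * otimes u v x))" by (simp only: mult_ac)
    also have "\<dots> \<le> c * ((1 + 1) * tail (V \<star> W) x)" using elim(1) c by (intro mult_left_mono) auto
    finally have "c1 * (exp (- \<alpha> * x) * u x) \<le> c * tail (V \<star> W) x" by (simp add: mult_ac)
    then show ?case using elim(2) tail_nonneg[OF RV] tail_nonneg[OF RVW] by simp
  qed
qed

section \<open>Several factors\<close>

lemma iterated_1 [simp]: "iterated g u (Suc 0) = u (Suc 0)"
  by (simp add: iterated_def)

lemma iterated_Suc: "k \<ge> 1 \<Longrightarrow> iterated g u (Suc k) = g (iterated g u k) (u (Suc k))"
  by (simp add: iterated_def)

lemma otimes_cmult: "otimes (\<lambda>x. c * u x) v x = c * otimes u v x"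
  by (simp add: otimes_def set_lebesgue_integral_def mult.assoc mult.left_commute[of _ c] flip: Bochner_Integration.integral_mult_right_zero)

text \<open>The convolution of the first \<open>i - 1\<close> distributions is lattice if and only if all of them are,
  which explains the condition in the product.\<close>

lemma exponential_tail_iterated:
  assumes \<alpha>: "\<alpha> > 0" and V: "\<And>i. i \<in> {1..N} \<Longrightarrow> exponential_tail \<alpha> (V i) (u i)" and k: "k \<in> {1..N}"
  shows "exponential_tail \<alpha> (conv_upto V k)
      (\<lambda>x. (\<Prod>i=2..k. if (\<forall>j\<in>{1..<i}. lattice_dist (V j)) \<or> lattice_dist (V i) then exp \<alpha> - 1 else \<alpha>) * iterated otimes u k x) \<and>
    (lattice_dist (conv_upto V k) \<longleftrightarrow> (\<forall>i\<in>{1..k}. lattice_dist (V i)))"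
  using k
proof (induction k)
  case 0
  then show ?case by simp
next
  case (Suc k)
  define \<kappa> where "\<kappa> = (\<lambda>i. if (\<forall>j\<in>{1..<i}. lattice_dist (V j)) \<or> lattice_dist (V i) then exp \<alpha> - 1 else \<alpha>)"
  show ?case
  proof (cases "k = 0")
    case True
    then show ?thesis using V[of 1] Suc.prems by (simp add: atLeastAtMost_singleton)
  next
    case False
    then have k: "k \<ge> 1" "k \<in> {1..N}" using Suc.prems by auto
    define C where "C = conv_upto V k"
    have IH: "exponential_tail \<alpha> C (\<lambda>x. (\<Prod>i=2..k. \<kappa> i) * iterated otimes u k x)"
      "lattice_dist C \<longleftrightarrow> (\<forall>i\<in>{1..k}. lattice_dist (V i))"
      using Suc.IH[OF k(2)] unfolding \<kappa>_def C_def by blast+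
    note VS = V[OF Suc.prems]
    have "lattice_dist (C \<star> V (Suc k)) \<longleftrightarrow> lattice_dist C \<and> lattice_dist (V (Suc k))"
      using IH(1) VS by (intro lattice_convolution(1)) (auto simp: exponential_tail_def)
    then have lat: "lattice_dist (C \<star> V (Suc k)) \<longleftrightarrow> (\<forall>i\<in>{1..Suc k}. lattice_dist (V i))"
      using IH(2) by (simp add: atLeastAtMostSuc_conv conj_commute)
    have "exponential_tail \<alpha> (C \<star> V (Suc k)) (\<lambda>x. tail_factor \<alpha> C (V (Suc k)) *
        otimes (\<lambda>x. (\<Prod>i=2..k. \<kappa> i) * iterated otimes u k x) (u (Suc k)) x)"
      by (rule exponential_tail_convolution[OF \<alpha> IH(1) VS])
    also have "tail_factor \<alpha> C (V (Suc k)) = \<kappa> (Suc k)"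
      by (simp add: tail_factor_def \<kappa>_def IH(2) atLeastLessThanSuc_atLeastAtMost)
    also have "(\<lambda>x. \<kappa> (Suc k) * otimes (\<lambda>x. (\<Prod>i=2..k. \<kappa> i) * iterated otimes u k x) (u (Suc k)) x) =
        (\<lambda>x. (\<Prod>i=2..Suc k. \<kappa> i) * iterated otimes u (Suc k) x)"
      using k(1) unfolding otimes_cmult iterated_Suc[OF k(1)] by (simp add: mult_ac)
    finally show ?thesis using lat k unfolding \<kappa>_def by (simp add: C_def iterated_Suc)
  qed
qed

text \<open>In the mixed pattern the factors for \<open>2 \<le> i \<le> m + 1\<close> are \<open>exp \<alpha> - 1\<close>, as \<open>V (m + 1)\<close> is
  convolved with a lattice distribution, and the remaining \<open>n - m - 1\<close> factors are \<open>\<alpha>\<close>.\<close>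

lemma rate_const_power:
  assumes "rate_const \<alpha> n V a" and n: "n \<ge> 1" and \<alpha>: "\<alpha> > 0"
  shows "(\<Prod>i=2..n. if (\<forall>j\<in>{1..<i}. lattice_dist (V j)) \<or> lattice_dist (V i) then exp \<alpha> - 1 else \<alpha>) = a ^ (n - 1)"
    (is "(\<Prod>i=2..n. ?c i) = _")
proof -
  have c2: "card {2..n} = n - 1" using n by simp
  from assms(1) consider (non) "\<forall>i\<in>{1..n + 1}. \<not> lattice_dist (V i)" "a = \<alpha>"
    | (lat) "\<forall>i\<in>{1..n + 1}. lattice_dist (V i)" "a = exp \<alpha> - 1"
    | (mix) m where "n \<ge> 2" "m \<in> {1..n - 1}" "\<forall>i\<in>{1..m}. lattice_dist (V i)" "\<forall>j\<in>{m + 1..n}. \<not> lattice_dist (V j)"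
        "a = (exp \<alpha> - 1) powr (real m / (real n - 1)) * \<alpha> powr ((real n - real m - 1) / (real n - 1))"
    unfolding rate_const_def by blast
  then show ?thesis
  proof cases
    case non
    have "?c i = \<alpha>" if "i \<in> {2..n}" for i
    proof -
      have "1 \<in> {1..<i}" "i \<in> {1..n + 1}" "1 \<in> {1..n + 1}" using that by auto
      then show ?thesis using non by metis
    qed
    then have "(\<Prod>i=2..n. ?c i) = (\<Prod>i=2..n. \<alpha>)" by (intro prod.cong) auto
    then show ?thesis using non c2 by simp
  next
    case lat
    then have "(\<Prod>i=2..n. ?c i) = (\<Prod>i=2..n. exp \<alpha> - 1)" by (intro prod.cong) auto
    then show ?thesis using lat c2 by simp
  next
    case mix
    have m: "1 \<le> m" "m + 1 \<le> n" using mix by auto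
    have "?c i = exp \<alpha> - 1" if "i \<in> {2..m + 1}" for i using mix that by auto
    moreover have "?c i = \<alpha>" if "i \<in> {m + 2..n}" for i
    proof -
      have "m + 1 \<in> {1..<i}" "m + 1 \<in> {m + 1..n}" "i \<in> {m + 1..n}" using that m by auto
      then show ?thesis using mix(4) by metis
    qed
    moreover have "{2..n} = {2..m + 1} \<union> {m + 2..n}" using m by auto
    then have "(\<Prod>i=2..n. ?c i) = (\<Prod>i=2..m + 1. ?c i) * (\<Prod>i=m + 2..n. ?c i)"
      by (simp only:) (rule prod.union_disjoint; auto)
    ultimately have p: "(\<Prod>i=2..n. ?c i) = (exp \<alpha> - 1) ^ m * \<alpha> ^ (n - m - 1)"
      using m by simp
    have e: "exp \<alpha> - 1 > 0" using \<alpha> by simp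
    have pow: "(b powr (r / (real n - 1))) ^ (n - 1) = b powr r" if "b > 0" for b r :: real
    proof -
      have "real (n - 1) = real n - 1" "real n - 1 \<noteq> 0" using mix(1) by (auto simp: of_nat_diff)
      then show ?thesis using that by (simp add: powr_realpow[symmetric] powr_powr)
    qed
    have "a ^ (n - 1) = (exp \<alpha> - 1) powr (real m) * \<alpha> powr (real n - real m - 1)"
      unfolding mix(5) power_mult_distrib pow[OF e] pow[OF \<alpha>] ..
    also have "real n - real m - 1 = real (n - m - 1)" using m by (simp add: of_nat_diff)
    finally show ?thesis using p e \<alpha> by (simp add: powr_realpow)
  qed
qed

theorem theorem1p1:
  fixes n :: nat and \<alpha> :: real
    and M :: "'w measure" and Y :: "nat \<Rightarrow> 'w \<Rightarrow> real"
    and V :: "nat \<Rightarrow> real measure" and f :: "nat \<Rightarrow> real \<Rightarrow> real"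
  assumes "n \<ge> 1" and "\<alpha> > 0"
    and "prob_space M"
    and "prob_space.indep_vars M (\<lambda>_. borel) Y {1..n + 1}"
    and "\<And>i. i \<in> {1..n + 1} \<Longrightarrow> V i = distr M borel (Y i)"
    and "\<And>i. i \<in> {1..n + 1} \<Longrightarrow> V i \<in> L1_dist \<alpha>"
    and "\<And>i. i \<in> {1..n + 1} \<Longrightarrow> associated \<alpha> (V i) (f i)"
  shows "conv_upto V n \<in> L1_dist \<alpha> \<and>
    (\<forall>a. rate_const \<alpha> n V a \<longrightarrow>
      tail (conv_upto V n) \<sim>[arg_filter {conv_upto V n}]
        (\<lambda>x. a ^ (n - 1) * exp (- \<alpha> * x) * iterated otimes (\<lambda>i. extended (V i) (f i)) n x)) \<and>
    tail (conv_upto V n) \<in> o[arg_filter {conv_upto V n, conv_upto V (n + 1)}](tail (conv_upto V (n + 1))) \<and>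
    (\<forall>j\<in>{1..n + 1}.
      (\<lambda>x. measure M {\<omega> \<in> space M. Max ((\<lambda>i. Y i \<omega>) ` {1..n + 1}) > x})
        \<in> o[arg_filter ((\<lambda>i. V i \<star> V j) ` ({1..n + 1} - {j}))](\<lambda>x.
            \<Sum>i\<in>{1..n + 1} - {j}. tail (V i \<star> V j) x))"
proof -
  interpret prob_space M by fact
  note \<alpha> = \<open>\<alpha> > 0\<close>
  define u where "u = (\<lambda>i. extended (V i) (f i))"
  have V: "exponential_tail \<alpha> (V i) (u i)" if "i \<in> {1..n + 1}" for i
    unfolding u_def by (rule exponential_tail_extended[OF \<alpha> assms(6,7)[OF that]])
  define c where "c = (\<Prod>i=2..n. if (\<forall>j\<in>{1..<i}. lattice_dist (V j)) \<or> lattice_dist (V i) then exp \<alpha> - 1 else \<alpha>)"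
  have Cn: "exponential_tail \<alpha> (conv_upto V n) (\<lambda>x. c * iterated otimes u n x)"
    using exponential_tail_iterated[OF \<alpha> V, of n] assms(1) by (simp add: c_def)
  have Vn: "exponential_tail \<alpha> (V (n + 1)) (u (n + 1))" by (rule V) simp
  have conv_Suc: "conv_upto V (n + 1) = (conv_upto V n \<star> V (n + 1))"
    using assms(1) by (simp add: iterated_Suc)
  have RV: "real_distribution (V i)" if "i \<in> {1..n + 1}" for i using V[OF that] by (simp add: exponential_tail_def)
  have 2: "tail (conv_upto V n) \<sim>[arg_filter {conv_upto V n}]
        (\<lambda>x. a ^ (n - 1) * exp (- \<alpha> * x) * iterated otimes u n x)" if a: "rate_const \<alpha> n V a" for a
  proof -
    have "arg_filter {conv_upto V n} = along (support_set (conv_upto V n))"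
      by (simp add: arg_filter_eq_along support_set_def)
    then show ?thesis
      using Cn rate_const_power[OF a assms(1) \<alpha>] by (simp add: exponential_tail_def c_def mult_ac)
  qed
  have 3: "tail (conv_upto V n) \<in> o[arg_filter {conv_upto V n, conv_upto V (n + 1)}](tail (conv_upto V (n + 1)))"
  proof -
    have "arg_filter {conv_upto V n, conv_upto V (n + 1)} \<le> along (support_set (conv_upto V n \<star> V (n + 1)))"
      unfolding arg_filter_eq_along conv_Suc by (intro along_mono) (auto simp: support_set_def)
    then show ?thesis
      unfolding conv_Suc by (rule landau_o.small.filter_mono) (rule tail_smallo_convolution[OF \<alpha> Cn Vn])
  qed
  have 4: "(\<lambda>x. measure M {\<omega> \<in> space M. Max ((\<lambda>i. Y i \<omega>) ` {1..n + 1}) > x})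
        \<in> o[arg_filter ((\<lambda>i. V i \<star> V j) ` ({1..n + 1} - {j}))](\<lambda>x. \<Sum>i\<in>{1..n + 1} - {j}. tail (V i \<star> V j) x)"
    (is "?P \<in> o[?F](?S)") if j: "j \<in> {1..n + 1}" for j
  proof -
    define I where "I = {1..n + 1} - {j}"
    have I: "finite I" "I \<noteq> {}" "I \<subseteq> {1..n + 1}" "{1..n + 1} = insert j I" "j \<notin> I"
    proof -
      have "(if j = 1 then 2 else 1) \<in> I" using assms(1) by (auto simp: I_def)
      then show "I \<noteq> {}" by blast
    qed (use j in \<open>auto simp: I_def\<close>)
    have Y: "Y i \<in> borel_measurable M" if "i \<in> {1..n + 1}" for i
      using assms(4) that by (auto simp: indep_vars_def)
    have tailY: "measure M {\<omega> \<in> space M. Y i \<omega> > x} = tail (V i) x" if i: "i \<in> {1..n + 1}" for i x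
    proof -
      have "emeasure (V i) {x<..} = emeasure M (Y i -` {x<..} \<inter> space M)"
        unfolding assms(5)[OF i] by (rule emeasure_distr[OF Y[OF i]]) simp
      also have "Y i -` {x<..} \<inter> space M = {\<omega> \<in> space M. Y i \<omega> > x}" by auto
      finally show ?thesis
        using emeasure_greaterThan_tail[OF RV[OF i], of x] tail_nonneg[OF RV[OF i], of x]
        by (simp add: emeasure_eq_measure)
    qed
    have le: "?P x \<le> (\<Sum>i\<in>{1..n + 1}. tail (V i) x)" for x
    proof -
      have "{\<omega> \<in> space M. Max ((\<lambda>i. Y i \<omega>) ` {1..n + 1}) > x} = (\<Union>i\<in>{1..n + 1}. {\<omega> \<in> space M. Y i \<omega> > x})"
        by (subst Max_gr_iff) auto
      also have "measure M \<dots> \<le> (\<Sum>i\<in>{1..n + 1}. measure M {\<omega> \<in> space M. Y i \<omega> > x})"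
        by (rule measure_UNION_le) (use Y in measurable)
      also have "\<dots> = (\<Sum>i\<in>{1..n + 1}. tail (V i) x)" by (rule sum.cong) (auto simp: tailY)
      finally show ?thesis .
    qed
    have S0: "0 \<le> tail (V i \<star> V j) x" if "i \<in> I" for i x
      using that I j by (intro tail_nonneg real_distribution_convolution RV) auto
    have Sle: "tail (V i \<star> V j) x \<le> ?S x" if "i \<in> I" for i x
      unfolding I_def[symmetric] by (rule member_le_sum[OF that]) (use S0 I in auto)
    have filt: "?F \<le> along (support_set (V i \<star> V j))" if "i \<in> I" for i
      unfolding arg_filter_eq_along using that by (intro along_mono) (auto simp: support_set_def I_def)
    \<comment> \<open>Every \<open>k\<close> occurs in some pair: \<open>k\<close> with \<open>j\<close> if \<open>k \<noteq> j\<close>, and \<open>j\<close> with any \<open>i\<close> otherwise.\<close>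
    have term_smallo: "tail (V k) \<in> o[?F](?S)" if ik: "i \<in> I" "k = i \<or> k = j" for i k
    proof -
      have i: "i \<in> {1..n + 1}" using ik I by auto
      have "tail (V k) \<in> o[along (support_set (V i \<star> V j))](tail (V i \<star> V j))"
        using ik(2) tail_smallo_convolution[OF \<alpha> V[OF i] V[OF j]] tail_smallo_convolution[OF \<alpha> V[OF j] V[OF i]]
          convolution_comm[OF RV[OF i] RV[OF j]] by auto
      then have "tail (V k) \<in> o[?F](tail (V i \<star> V j))" by (rule landau_o.small.filter_mono[OF filt[OF ik(1)]])
      moreover have "tail (V i \<star> V j) \<in> O[?F](?S)"
        using S0[OF ik(1)] Sle[OF ik(1)] order_trans[OF S0[OF ik(1)] Sle[OF ik(1)]]
        by (intro landau_o.big_mono always_eventually allI) simp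
      ultimately show ?thesis by (rule landau_o.small_big_trans)
    qed
    have "tail (V k) \<in> o[?F](?S)" if "k \<in> {1..n + 1}" for k
    proof (cases "k = j")
      case True
      then show ?thesis using term_smallo I(2) by blast
    next
      case False
      then show ?thesis using term_smallo[of k k] that by (auto simp: I_def)
    qed
    then have "(\<lambda>x. \<Sum>k\<in>{1..n + 1}. tail (V k) x) \<in> o[?F](?S)" by (intro big_sum_in_smallo) auto
    moreover have "?P \<in> O[?F](\<lambda>x. \<Sum>k\<in>{1..n + 1}. tail (V k) x)"
      using le order_trans[OF measure_nonneg le] by (intro landau_o.big_mono always_eventually allI) simp
    ultimately show ?thesis by (rule landau_o.big_small_trans[rotated])
  qed
  show ?thesis
    using L1_dist_of_exponential_tail[OF Cn] 2 3 4 unfolding u_def by blast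
qed

end
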